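(* Let $\lambda$ and $\mu$ be partitions of $n$ and choose $d$ and $t$ with $d \geq 1$ and $0 \leq t < \mu_{d+1}$. Let $\nu = \nu^{d,t}$ and write $\bar{t}=\mu_{d+1}-t$. Suppose $A \in \mathcal{T}(\lambda,\mu)$ is a row standard tableau. Let $\mathcal{S} \subseteq \mathcal{T}(\lambda,\nu)$ be the set of row standard tableaux obtained by replacing $\bar{t}$ entries of $d+1$ in $A$ with $d$. For $S \in \mathcal{S}$ and $i\geq 1$, let $\beta_{i}$ be the number of entries that were replaced in row $i$, and define $b_S\in F$ by \[b_S= \prod_{i \geq 1} q^{x_i \beta_i} \genfrac{[}{]}{0pt}{}{y_i}{\beta_i},\] where $x_i$ is the cardinality of the set $\{(k,j) \mid k>i \text{ and } A(k,j)=d\}$ and $y_i$ is the cardinality of the set $\{j \mid S(i,j)=d\}$. Then \[ \psi_{d,t}\, \Theta_A = \sum_{S \in \mathcal{S}} b_S\, \Theta_S.\]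
   Context: $F$ is a field, $q\in F$ is invertible and $n\ge1$. For an integer $\alpha\ge0$, $[\alpha]=1+q+\dots+q^{\alpha-1}$ with $[0]=0$, $[\alpha]!=[1][2]\cdots[\alpha]$ with $[0]!=1$, and for $\alpha\ge\beta\ge0$ the Gaussian polynomial is $\genfrac{[}{]}{0pt}{}{\alpha}{\beta}=\frac{[\alpha]!}{[\beta]!\,[\alpha-\beta]!}$, which is a polynomial in $q$ with integer coefficients and is evaluated as such in $F$. The symmetric group $\mathfrak S_n$ acts on $\{1,\dots,n\}$ from the right (products are read left to right); $s_i=(i,i+1)$ and $\ell(w)$ is the length of $w$ in the generators $s_i$. $\mathcal H=\mathcal H_{F,q}(\mathfrak S_n)$ is the associative $F$-algebra with basis $\{T_w\mid w\in\mathfrak S_n\}$ and multiplication determined by $T_wT_{s_i}=T_{ws_i}$ if $\ell(ws_i)=\ell(w)+1$ and $T_wT_{s_i}=qT_{ws_i}+(q-1)T_w$ if $\ell(ws_i)=\ell(w)-1$. For a composition $\lambda$ of $n$, the diagram of $\lambda$ is $\{(i,j)\mid i\geq 1,\ 1\le j\le\lambda_i\}$; a $\lambda$-tableau is (unless a type is specified) a filling of it by $1,\dots,n$, on which $\mathfrak S_n$ acts from the right by permuting entries. $\mathfrak t^\lambda$ is the $\lambda$-tableau with $1,\dots,n$ entered in order along the rows, $\mathfrak S_\lambda$ is its row stabilizer, $x_\lambda=\sum_{w\in\mathfrak S_\lambda}T_w$ and $M^\lambda=x_\lambda\mathcal H$. For compositions $\lambda,\mu$ of $n$, $\mathcal T(\lambda,\mu)$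 is the set of $\lambda$-tableaux of type $\mu$ (fillings of the diagram of $\lambda$ with exactly $\mu_i$ entries equal to $i$ for each $i$); $A(a,b)$ is the entry of $A$ in position $(a,b)$. Such a tableau is row standard if its entries weakly increase along rows. Write $A\sim_r B$ if, for each $i$, row $i$ of $A$ and row $i$ of $B$ contain the same entries with multiplicity. For $A\in\mathcal T(\lambda,\mu)$, $1_A\in\mathfrak S_n$ is the permutation such that $\mathfrak t^\mu 1_A$ is the $\mu$-tableau with increasing rows in which $i$ lies in row $r$ if the position occupied by $i$ in $\mathfrak t^\lambda$ is occupied by $r$ in $A$. The $\mathcal H$-homomorphism $\Theta_A:M^\lambda\to M^\mu$ is given by $\Theta_A(x_\lambda h)=\big(x_\mu\sum_{A'\sim_rA}T_{1_{A'}}\big)h$ for $h\in\mathcal H$. For a partition $\mu$, $d\ge1$ and $0\le t<\mu_{d+1}$, $\nu^{d,t}$ is the composition with $\nu^{d,t}_d=\mu_d+\mu_{d+1}-t$, $\nu^{d,t}_{d+1}=t$ and $\nu^{d,t}_i=\mu_i$ otherwise. $\psi_{d,t}=\Theta_R:M^\mu\to M^{\nu^{d,t}}$, where $R$ is the row standard $\mu$-tableau of type $\nu^{d,t}$ in which all entries in row $i$ equal $i$, except that row $d+1$ contains $\mu_{d+1}-t$ entries equal to $d$ and $t$ entries equal to $d+1$. *)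

theory Defs
  imports
    "HOL-Combinatorics.Permutations"
    "HOL-Combinatorics.Transposition"
    "HOL-Library.FuncSet"
    "HOL-Library.Multiset"
    "HOL-Computational_Algebra.Polynomial"
begin

section \<open>Gaussian polynomials\<close>

definition qnum :: "nat \<Rightarrow> int poly" where
  "qnum a = (\<Sum>k<a. monom 1 k)"

definition qfact :: "nat \<Rightarrow> int poly" where
  "qfact a = (\<Prod>k=1..a. qnum k)"

text \<open>Meaningful for \<open>b \<le> a\<close> only; the division of integer polynomials is then exact.\<close>

definition gauss_poly :: "nat \<Rightarrow> nat \<Rightarrow> int poly" where
  "gauss_poly a b = qfact a div (qfact b * qfact (a - b))"

definition gauss :: "'f::field \<Rightarrow> nat \<Rightarrow> nat \<Rightarrow> 'f" where
  "gauss q a b = poly (map_poly of_int (gauss_poly a b)) q"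

section \<open>The symmetric group\<close>

text \<open>
  A permutation of \<open>{1..n}\<close> is a function \<open>w\<close> with \<open>w permutes {1..n}\<close>, and it acts from the
  right: \<open>i w\<close> is \<open>w i\<close>. The product \<open>v w\<close>, read from left to right, is therefore \<open>w \<circ> v\<close>;
  in particular \<open>w s\<^sub>i\<close> is \<open>sgen i \<circ> w\<close>.
\<close>

definition Sym :: "nat \<Rightarrow> (nat \<Rightarrow> nat) set" where
  "Sym n = {w. w permutes {1..n}}"

definition sgen :: "nat \<Rightarrow> nat \<Rightarrow> nat" where
  "sgen i = transpose i (Suc i)"

definition word_perm :: "nat list \<Rightarrow> nat \<Rightarrow> nat" where
  "word_perm is = foldl (\<lambda>w i. sgen i \<circ> w) id is"

definition perm_length :: "nat \<Rightarrow> (nat \<Rightarrow> nat) \<Rightarrow> nat" where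
  "perm_length n w = (LEAST k. \<exists>is. length is = k \<and> set is \<subseteq> {1..<n} \<and> word_perm is = w)"

section \<open>The Hecke algebra\<close>

text \<open>
  The \<open>F\<close>-algebra is the type \<open>'h\<close> with scalar multiplication \<open>scale\<close>; its basis element
  indexed by the permutation \<open>w\<close> is \<open>T w\<close>. Values of \<open>T\<close> outside \<open>Sym n\<close> are irrelevant.
\<close>

locale hecke_algebra = vector_space scale
  for scale :: "'f::field \<Rightarrow> 'h::ring_1 \<Rightarrow> 'h" +
  fixes n :: nat and q :: 'f and T :: "(nat \<Rightarrow> nat) \<Rightarrow> 'h"
  assumes scale_mult_left: "scale a x * y = scale a (x * y)"
    and scale_mult_right: "x * scale a y = scale a (x * y)"
    and T_inj: "inj_on T (Sym n)"
    and T_independent: "independent (T ` Sym n)"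
    and T_span: "span (T ` Sym n) = UNIV"
    and T_mult_up: "\<lbrakk>w \<in> Sym n; i \<in> {1..<n}; perm_length n (sgen i \<circ> w) = perm_length n w + 1\<rbrakk>
      \<Longrightarrow> T w * T (sgen i) = T (sgen i \<circ> w)"
    and T_mult_down: "\<lbrakk>w \<in> Sym n; i \<in> {1..<n}; perm_length n w = perm_length n (sgen i \<circ> w) + 1\<rbrakk>
      \<Longrightarrow> T w * T (sgen i) = scale q (T (sgen i \<circ> w)) + scale (q - 1) (T w)"

section \<open>Compositions and tableaux\<close>

text \<open>
  A composition is a finitely supported function of its index \<open>i \<ge> 1\<close>, made total by the value 0
  at index 0. Zero parts are allowed anywhere.
\<close>

definition composition :: "nat \<Rightarrow> (nat \<Rightarrow> nat) \<Rightarrow> bool" where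
  "composition n lam \<longleftrightarrow> lam 0 = 0 \<and> finite {i. lam i \<noteq> 0} \<and> (\<Sum>i | lam i \<noteq> 0. lam i) = n"

definition is_partition :: "nat \<Rightarrow> (nat \<Rightarrow> nat) \<Rightarrow> bool" where
  "is_partition n lam \<longleftrightarrow> composition n lam \<and> (\<forall>i\<ge>1. lam (Suc i) \<le> lam i)"

definition diagram :: "(nat \<Rightarrow> nat) \<Rightarrow> (nat \<times> nat) set" where
  "diagram lam = {(i, j). 1 \<le> i \<and> 1 \<le> j \<and> j \<le> lam i}"

text \<open>
  Tableaux with repeated entries are extensional functions (\<open>undefined\<close> off the diagram), so that
  equality of tableaux is equality of functions.
\<close>

definition tableaux :: "(nat \<Rightarrow> nat) \<Rightarrow> (nat \<Rightarrow> nat) \<Rightarrow> (nat \<times> nat \<Rightarrow> nat) set" where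
  "tableaux lam mu =
    {A \<in> diagram lam \<rightarrow>\<^sub>E {1..}. \<forall>i\<ge>1. card {p \<in> diagram lam. A p = i} = mu i}"

definition row_standard :: "(nat \<Rightarrow> nat) \<Rightarrow> (nat \<times> nat \<Rightarrow> nat) \<Rightarrow> bool" where
  "row_standard lam A \<longleftrightarrow>
    (\<forall>i j k. (i, j) \<in> diagram lam \<and> (i, k) \<in> diagram lam \<and> j \<le> k \<longrightarrow> A (i, j) \<le> A (i, k))"

definition row_mset :: "(nat \<Rightarrow> nat) \<Rightarrow> (nat \<times> nat \<Rightarrow> nat) \<Rightarrow> nat \<Rightarrow> nat multiset" where
  "row_mset lam A i = image_mset (\<lambda>j. A (i, j)) (mset_set {j. (i, j) \<in> diagram lam})"

definition row_equiv ::
    "(nat \<Rightarrow> nat) \<Rightarrow> (nat \<times> nat \<Rightarrow> nat) \<Rightarrow> (nat \<times> nat \<Rightarrow> nat) \<Rightarrow> bool" where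
  "row_equiv lam A B \<longleftrightarrow> (\<forall>i\<ge>1. row_mset lam A i = row_mset lam B i)"

text \<open>The tableau \<open>t\<^sup>\<lambda>\<close>. A permutation \<open>w\<close> sends a tableau \<open>t\<close> with entries \<open>1..n\<close> to \<open>w \<circ> t\<close>.\<close>

definition init_tab :: "(nat \<Rightarrow> nat) \<Rightarrow> nat \<times> nat \<Rightarrow> nat" where
  "init_tab lam = (\<lambda>(i, j). (\<Sum>k\<in>{1..<i}. lam k) + j)"

definition row_entries :: "(nat \<Rightarrow> nat) \<Rightarrow> (nat \<times> nat \<Rightarrow> nat) \<Rightarrow> nat \<Rightarrow> nat set" where
  "row_entries lam t i = {t (i, j) | j. (i, j) \<in> diagram lam}"

definition row_stabilizer :: "nat \<Rightarrow> (nat \<Rightarrow> nat) \<Rightarrow> (nat \<Rightarrow> nat) set" where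
  "row_stabilizer n lam = {w \<in> Sym n.
    \<forall>i\<ge>1. row_entries lam (w \<circ> init_tab lam) i = row_entries lam (init_tab lam) i}"

text \<open>The permutation \<open>1\<^sub>A\<close> of a \<open>lam\<close>-tableau \<open>A\<close> of type \<open>mu\<close>.\<close>

definition tab_perm ::
    "nat \<Rightarrow> (nat \<Rightarrow> nat) \<Rightarrow> (nat \<Rightarrow> nat) \<Rightarrow> (nat \<times> nat \<Rightarrow> nat) \<Rightarrow> nat \<Rightarrow> nat" where
  "tab_perm n lam mu A = (THE w. w \<in> Sym n \<and> row_standard mu (w \<circ> init_tab mu) \<and>
    (\<forall>p \<in> diagram lam. init_tab lam p \<in> row_entries mu (w \<circ> init_tab mu) (A p)))"

section \<open>Permutation modules and homomorphisms\<close>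

definition x_elt :: "nat \<Rightarrow> ((nat \<Rightarrow> nat) \<Rightarrow> 'h::ring_1) \<Rightarrow> (nat \<Rightarrow> nat) \<Rightarrow> 'h" where
  "x_elt n T lam = (\<Sum>w\<in>row_stabilizer n lam. T w)"

definition perm_module :: "nat \<Rightarrow> ((nat \<Rightarrow> nat) \<Rightarrow> 'h::ring_1) \<Rightarrow> (nat \<Rightarrow> nat) \<Rightarrow> 'h set" where
  "perm_module n T lam = {x_elt n T lam * h | h. True}"

text \<open>
  The homomorphism \<open>\<Theta>\<^sub>A\<close> from \<open>M\<^sup>\<lambda>\<close> to \<open>M\<^sup>\<mu>\<close>, determined on \<open>M\<^sup>\<lambda>\<close> by
  \<open>x\<^sub>\<lambda> h \<mapsto> (x\<^sub>\<mu> \<Sum>\<^sub>B T\<^sub>1\<^sub>B) h\<close> with \<open>B\<close> ranging over the tableaux row equivalent to \<open>A\<close>;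
  its values outside \<open>M\<^sup>\<lambda>\<close> are meaningless.
\<close>

definition Theta :: "nat \<Rightarrow> ((nat \<Rightarrow> nat) \<Rightarrow> 'h::ring_1) \<Rightarrow> (nat \<Rightarrow> nat) \<Rightarrow> (nat \<Rightarrow> nat) \<Rightarrow>
    (nat \<times> nat \<Rightarrow> nat) \<Rightarrow> 'h \<Rightarrow> 'h" where
  "Theta n T lam mu A m = (THE v. \<exists>h. m = x_elt n T lam * h \<and>
    v = (x_elt n T mu *
      (\<Sum>B | B \<in> tableaux lam mu \<and> row_equiv lam B A. T (tab_perm n lam mu B))) * h)"

definition nu_comp :: "(nat \<Rightarrow> nat) \<Rightarrow> nat \<Rightarrow> nat \<Rightarrow> nat \<Rightarrow> nat" where
  "nu_comp mu d t = mu(d := mu d + mu (d + 1) - t, d + 1 := t)"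

definition psi_tab :: "(nat \<Rightarrow> nat) \<Rightarrow> nat \<Rightarrow> nat \<Rightarrow> nat \<times> nat \<Rightarrow> nat" where
  "psi_tab mu d t = (\<lambda>(i, j) \<in> diagram mu. if i = d + 1 \<and> j \<le> mu (d + 1) - t then d else i)"

definition psi :: "nat \<Rightarrow> ((nat \<Rightarrow> nat) \<Rightarrow> 'h::ring_1) \<Rightarrow> (nat \<Rightarrow> nat) \<Rightarrow> nat \<Rightarrow> nat \<Rightarrow> 'h \<Rightarrow> 'h" where
  "psi n T mu d t = Theta n T mu (nu_comp mu d t) (psi_tab mu d t)"

section \<open>Replacing entries \<open>d + 1\<close> by \<open>d\<close>\<close>

definition replaced_tableaux :: "(nat \<Rightarrow> nat) \<Rightarrow> (nat \<Rightarrow> nat) \<Rightarrow> nat \<Rightarrow> nat \<Rightarrow>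
    (nat \<times> nat \<Rightarrow> nat) \<Rightarrow> (nat \<times> nat \<Rightarrow> nat) set" where
  "replaced_tableaux lam mu d t A = {S \<in> tableaux lam (nu_comp mu d t). row_standard lam S \<and>
    (\<exists>X \<subseteq> {p \<in> diagram lam. A p = d + 1}. card X = mu (d + 1) - t \<and>
      S = (\<lambda>p. if p \<in> X then d else A p))}"

definition num_replaced ::
    "(nat \<Rightarrow> nat) \<Rightarrow> (nat \<times> nat \<Rightarrow> nat) \<Rightarrow> (nat \<times> nat \<Rightarrow> nat) \<Rightarrow> nat \<Rightarrow> nat" where
  "num_replaced lam A S i = card {j. (i, j) \<in> diagram lam \<and> S (i, j) \<noteq> A (i, j)}"

text \<open>The rows outside the index set of the product are empty and would contribute the factor 1.\<close>

definition b_coeff :: "'f::field \<Rightarrow> (nat \<Rightarrow> nat) \<Rightarrow> nat \<Rightarrow>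
    (nat \<times> nat \<Rightarrow> nat) \<Rightarrow> (nat \<times> nat \<Rightarrow> nat) \<Rightarrow> 'f" where
  "b_coeff q lam d A S = (\<Prod>i | 1 \<le> i \<and> lam i \<noteq> 0.
    q ^ (card {(k, j) \<in> diagram lam. k > i \<and> A (k, j) = d} * num_replaced lam A S i) *
    gauss q (card {j. (i, j) \<in> diagram lam \<and> S (i, j) = d}) (num_replaced lam A S i))"

end

theory Submission
  imports Defs
begin

text \<open>
  The proof replaces permutations by words. Let \<open>r x\<close> be the row of \<open>t\<^sup>\<mu>\<close> that contains \<open>x\<close>. The word of a
  permutation \<open>w\<close> is \<open>c = r \<circ> inv w\<close>, so that \<open>x\<close> lies in row \<open>c x\<close> of \<open>t\<^sup>\<mu> w\<close>, and the permutations with a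
  given word form a right coset of the row stabilizer. Write \<open>[c]\<close> for the sum of \<open>T w\<close> over the \<open>w\<close>
  with word \<open>c\<close> (\<open>word_sum\<close>). Then \<open>x\<^sub>\<mu> = [r]\<close>, and \<open>[c] T\<^sub>i = [c s\<^sub>i]\<close> if \<open>c i < c (i+1)\<close> while
  \<open>[c] T\<^sub>i = q [c]\<close> if \<open>c i = c (i+1)\<close> (\<open>word_sum_ascent\<close>, \<open>word_sum_equal\<close>). Reaching \<open>1\<^sub>B\<close> through such
  exchanges gives \<open>x\<^sub>\<mu> T (1\<^sub>B) = [c\<^sub>B]\<close>, where \<open>c\<^sub>B x\<close> is the entry of \<open>B\<close> in the box occupied by \<open>x\<close> in
  \<open>t\<^sup>\<lambda>\<close>. Hence \<open>\<Theta>\<^sub>A\<close> maps \<open>x\<^sub>\<lambda>\<close> to the sum of the words of the tableaux row equivalent to \<open>A\<close>. That this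
  prescribes a map on \<open>x\<^sub>\<lambda> H\<close> holds because the sum runs over a union of left cosets of the row
  stabilizer of \<open>\<lambda>\<close> and is therefore a left multiple of \<open>x\<^sub>\<lambda>\<close> (\<open>coset_closed_sum\<close>, \<open>Theta_eval\<close>).

  In the same language the image of \<open>[c]\<close> under \<open>\<psi>\<close> is the sum, over the sets \<open>X\<close> of \<open>\<mu>\<^sub>d\<^sub>+\<^sub>1 - t\<close> positions
  of the letter \<open>d + 1\<close> in \<open>c\<close>, of \<open>q\<^sup>e [c\<^sub>X]\<close>. Here \<open>c\<^sub>X\<close> has the letters at \<open>X\<close> replaced by \<open>d\<close>, and \<open>e\<close>
  counts the pairs of a position in \<open>X\<close> and a later letter \<open>d\<close> of \<open>c\<close> (\<open>merge_word\<close>). For \<open>c = r\<close> all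
  exponents vanish and this is the definition of \<open>\<psi>\<close>; the formula survives exchanging two ascending
  neighbours (\<open>merge_word_ascent\<close>), because an exchange creates a new pair exactly when the letters
  \<open>d\<close> and \<open>d + 1\<close> at the two places are merged, and then \<open>T\<^sub>i\<close> contributes the matching factor \<open>q\<close>.

  It remains to apply this to the words of all \<open>B\<close> row equivalent to \<open>A\<close> and to collect equal results
  \<open>R\<close>. A result \<open>R\<close> arises from the sets \<open>X\<close> that contain \<open>\<beta>\<^sub>i\<close> of the \<open>y\<^sub>i\<close> boxes of row \<open>i\<close> with entry \<open>d\<close>
  (\<open>replacement_bij\<close>). The exponent splits over the rows: entries \<open>d\<close> in later rows give \<open>x\<^sub>i \<beta>\<^sub>i\<close>, and
  the pairs inside a row form the inversion statistic of a subset, whose generating function is the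
  Gaussian polynomial (\<open>sum_subsets_gauss\<close>). The product over the rows is \<open>b\<^sub>S\<close> (\<open>sum_row_choices\<close>).
\<close>

section \<open>Inversions and the length function\<close>

text \<open>
  As permutations act from the right, the product \<open>w s\<^sub>i\<close> is \<open>sgen i \<circ> w\<close>: it exchanges the values
  \<open>i\<close> and \<open>i + 1\<close>. It is longer than \<open>w\<close> precisely when \<open>i\<close> stands to the left of \<open>i + 1\<close>.
\<close>

definition inversions :: "nat \<Rightarrow> (nat \<Rightarrow> nat) \<Rightarrow> (nat \<times> nat) set" where
  "inversions n w = {(a, b). a \<in> {1..n} \<and> b \<in> {1..n} \<and> a < b \<and> w b < w a}"

definition ascent :: "(nat \<Rightarrow> nat) \<Rightarrow> nat \<Rightarrow> bool" where
  "ascent w i \<longleftrightarrow> inv w i < inv w (Suc i)"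

lemma finite_inversions [simp]: "finite (inversions n w)"
  by (rule finite_subset[of _ "{1..n} \<times> {1..n}"]) (auto simp: inversions_def)

lemma finite_Sym [simp]: "finite (Sym n)"
  by (simp add: Sym_def finite_permutations)

lemma sgen_Sym: "i \<in> {1..<n} \<Longrightarrow> sgen i \<in> Sym n"
  by (simp add: Sym_def sgen_def permutes_swap_id)

lemma sgen_sgen [simp]: "sgen i (sgen i x) = x"
  by (simp add: sgen_def)

lemma sgen_comp_sgen [simp]: "sgen i \<circ> (sgen i \<circ> f) = f"
  by (simp add: fun_eq_iff)

lemma inv_sgen [simp]: "inv (sgen i) = sgen i"
  by (simp add: sgen_def)

lemma sgen_apply [simp]: "sgen i i = Suc i" "sgen i (Suc i) = i"
  by (simp_all add: sgen_def)

lemma sgen_less_iff: 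
  assumes "x \<noteq> y" "\<not> (x = i \<and> y = Suc i)" "\<not> (x = Suc i \<and> y = i)"
  shows "sgen i x < sgen i y \<longleftrightarrow> x < y"
  using assms by (auto simp: sgen_def transpose_def)

lemma Sym_comp: "u \<in> Sym n \<Longrightarrow> w \<in> Sym n \<Longrightarrow> u \<circ> w \<in> Sym n"
  by (simp add: Sym_def permutes_compose)

lemma Sym_inv: "w \<in> Sym n \<Longrightarrow> inv w \<in> Sym n"
  by (simp add: Sym_def permutes_inv)

lemma Sym_id: "id \<in> Sym n"
  by (simp add: Sym_def permutes_id)

lemma Sym_inverses: "w \<in> Sym n \<Longrightarrow> inv w (w x) = x" "w \<in> Sym n \<Longrightarrow> w (inv w x) = x"
  by (auto simp: Sym_def permutes_inverses)

lemma Sym_in: "w \<in> Sym n \<Longrightarrow> w x \<in> {1..n} \<longleftrightarrow> x \<in> {1..n}"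
  unfolding Sym_def by (blast dest: permutes_in_image)

lemma Sym_eq_iff: "w \<in> Sym n \<Longrightarrow> w x = w y \<longleftrightarrow> x = y"
  by (metis Sym_inverses(1))

lemma inv_sgen_comp: 
  assumes "w \<in> Sym n" shows "inv (sgen i \<circ> w) = inv w \<circ> sgen i"
proof -
  have "bij w" "bij (sgen i)" using assms by (auto simp: Sym_def permutes_bij sgen_def)
  then show ?thesis by (simp add: o_inv_distrib)
qed

lemma not_ascent:
  assumes "w \<in> Sym n" "\<not> ascent w i" shows "ascent (sgen i \<circ> w) i"
  using assms Sym_eq_iff[OF Sym_inv[OF assms(1)], of i "Suc i"]
  by (simp add: ascent_def inv_sgen_comp)

text \<open>
  Only the pair of positions that hold the values \<open>i\<close> and \<open>i + 1\<close> changes its relative order.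
\<close>

lemma card_inversions_ascent:
  assumes w: "w \<in> Sym n" and i: "i \<in> {1..<n}" and a: "ascent w i"
  shows "card (inversions n (sgen i \<circ> w)) = Suc (card (inversions n w))"
proof -
  obtain x y where x: "x = inv w i" and y: "y = inv w (Suc i)" by blast
  have xy: "w x = i" "w y = Suc i" by (simp_all add: x y Sym_inverses[OF w])
  have in1: "x \<in> {1..n}" "y \<in> {1..n}"
    using i Sym_in[OF w, of x] Sym_in[OF w, of y] by (auto simp: xy)
  have lt: "x < y" using a by (simp add: ascent_def x y)
  have inj: "w p = w r \<longleftrightarrow> p = r" for p r by (rule Sym_eq_iff[OF w])
  have "(p, r) \<in> inversions n (sgen i \<circ> w) \<longleftrightarrow> (p, r) = (x, y) \<or> (p, r) \<in> inversions n w" for p r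
  proof (cases "(p = x \<and> r = y) \<or> (p = y \<and> r = x)")
    case True
    then show ?thesis
    proof
      assume "p = x \<and> r = y"
      then show ?thesis using lt in1 by (simp add: inversions_def xy)
    next
      assume "p = y \<and> r = x"
      then show ?thesis using lt by (simp add: inversions_def)
    qed
  next
    case False
    show ?thesis
    proof (cases "p = r")
      case True then show ?thesis using lt by (auto simp: inversions_def)
    next
      case F: False
      have "sgen i (w r) < sgen i (w p) \<longleftrightarrow> w r < w p"
        using False F inj xy by (intro sgen_less_iff) metis+
      then show ?thesis using False by (auto simp: inversions_def)
    qed
  qed
  then have "inversions n (sgen i \<circ> w) = insert (x, y) (inversions n w)"
    unfolding set_eq_iff split_paired_All insert_iff by blast
  moreover have "(x, y) \<notin> inversions n w" by (simp add: inversions_def xy)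
  ultimately show ?thesis by simp
qed

lemma all_ascents_id:
  assumes w: "w \<in> Sym n" and a: "\<And>i. i \<in> {1..<n} \<Longrightarrow> ascent w i"
  shows "w = id"
proof -
  have ge: "i \<le> inv w i" if "i \<in> {1..n}" for i
    using that
  proof (induction i)
    case (Suc i)
    show ?case
    proof (cases "i = 0")
      case True then show ?thesis using Suc.prems Sym_in[OF Sym_inv[OF w], of "Suc i"] by auto
    next
      case False
      then have "inv w i < inv w (Suc i)" using Suc.prems a[of i] by (auto simp: ascent_def)
      then show ?thesis using Suc.IH Suc.prems False by auto
    qed
  qed auto
  have "inv w permutes {1..n}" using Sym_inv[OF w] by (simp add: Sym_def)
  then have "inv w = id" using ge by (intro permutes_natset_ge) auto
  then show ?thesis by (metis Sym_inverses(2)[OF w] ext id_apply)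
qed

text \<open>
  Sorting a permutation by adjacent exchanges of values, read backwards: every permutation is built
  from the identity by steps that each create one inversion.
\<close>

lemma Sym_ascent_induct [consumes 1, case_names id ascent]:
  assumes "w \<in> Sym n"
    and "P id"
    and "\<And>w i. w \<in> Sym n \<Longrightarrow> i \<in> {1..<n} \<Longrightarrow> ascent w i \<Longrightarrow> P w \<Longrightarrow> P (sgen i \<circ> w)"
  shows "P w"
  using assms(1)
proof (induction "card (inversions n w)" arbitrary: w rule: less_induct)
  case less
  show ?case
  proof (cases "\<exists>i\<in>{1..<n}. \<not> ascent w i")
    case True
    then obtain i where i: "i \<in> {1..<n}" "\<not> ascent w i" by blast
    let ?v = "sgen i \<circ> w"
    have v: "?v \<in> Sym n" using i less.prems by (simp add: Sym_comp sgen_Sym)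
    have a: "ascent ?v i" using not_ascent[OF less.prems i(2)] .
    have "card (inversions n ?v) < card (inversions n w)"
      using card_inversions_ascent[OF v i(1) a] by simp
    then have "P ?v" using less.hyps v by blast
    then have "P (sgen i \<circ> ?v)" using assms(3) v i(1) a by blast
    then show ?thesis by simp
  next
    case False
    then have "w = id" using all_ascents_id less.prems by blast
    then show ?thesis using assms(2) by simp
  qed
qed

lemma word_perm_Nil: "word_perm [] = id"
  by (simp add: word_perm_def)

lemma word_perm_snoc: "word_perm (is @ [i]) = sgen i \<circ> word_perm is"
  by (simp add: word_perm_def)

lemma perm_length_eq:
  assumes "w \<in> Sym n" shows "perm_length n w = card (inversions n w)"
proof -
  have ex: "\<exists>is. length is = card (inversions n w) \<and> set is \<subseteq> {1..<n} \<and> word_perm is = w"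
    using assms
  proof (induction rule: Sym_ascent_induct)
    case id
    have "inversions n id = {}" by (auto simp: inversions_def)
    then show ?case by (intro exI[of _ "[]"]) (simp add: word_perm_def id_def)
  next
    case (ascent w i)
    then obtain is' where "length is' = card (inversions n w)" "set is' \<subseteq> {1..<n}" "word_perm is' = w" by blast
    then have "length (is' @ [i]) = card (inversions n (sgen i \<circ> w))"
      "set (is' @ [i]) \<subseteq> {1..<n}" "word_perm (is' @ [i]) = sgen i \<circ> w"
      using ascent.hyps card_inversions_ascent[OF ascent.hyps(1-3)]
      by (auto simp only: word_perm_snoc length_append) auto
    then show ?case by blast
  qed
  have le: "word_perm is \<in> Sym n \<and> card (inversions n (word_perm is)) \<le> length is" if "set is \<subseteq> {1..<n}" for "is"
    using that
  proof (induction "is" rule: rev_induct)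
    case Nil
    have "inversions n id = {}" by (auto simp: inversions_def)
    then show ?case using Sym_id by (metis word_perm_Nil card.empty le0)
  next
    case (snoc i js)
    let ?w = "word_perm js"
    have i: "i \<in> {1..<n}" and w: "?w \<in> Sym n" and l: "card (inversions n ?w) \<le> length js"
      using snoc by auto
    have v: "sgen i \<circ> ?w \<in> Sym n" using w i by (simp add: Sym_comp sgen_Sym)
    show ?case
    proof (cases "ascent ?w i")
      case True
      then show ?thesis using card_inversions_ascent[OF w i True] v l
        by (metis Suc_le_mono length_append_singleton word_perm_snoc)
    next
      case False
      then show ?thesis using card_inversions_ascent[OF v i not_ascent[OF w False]] v l
        by (metis Suc_leD le_SucI length_append_singleton sgen_comp_sgen word_perm_snoc)
    qed
  qed
  show ?thesis unfolding perm_length_def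
  proof (rule Least_equality)
    show "\<exists>is. length is = card (inversions n w) \<and> set is \<subseteq> {1..<n} \<and> word_perm is = w"
      by (rule ex)
    show "card (inversions n w) \<le> k"
      if "\<exists>is. length is = k \<and> set is \<subseteq> {1..<n} \<and> word_perm is = w" for k
      using that le by metis
  qed
qed

section \<open>Multiplication of basis elements\<close>

context hecke_algebra
begin

lemma T_ascent:
  assumes "w \<in> Sym n" "i \<in> {1..<n}" "ascent w i"
  shows "T w * T (sgen i) = T (sgen i \<circ> w)"
proof (rule T_mult_up)
  have "sgen i \<circ> w \<in> Sym n" using assms by (simp add: Sym_comp sgen_Sym)
  then show "perm_length n (sgen i \<circ> w) = perm_length n w + 1"
    using assms by (simp add: perm_length_eq card_inversions_ascent)
qed (use assms in auto)

lemma T_ascent_quadratic: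
  assumes "w \<in> Sym n" "i \<in> {1..<n}" "ascent w i"
  shows "T (sgen i \<circ> w) * T (sgen i) = scale q (T w) + scale (q - 1) (T (sgen i \<circ> w))"
proof -
  have v: "sgen i \<circ> w \<in> Sym n" using assms by (simp add: Sym_comp sgen_Sym)
  have "T (sgen i \<circ> w) * T (sgen i) =
    scale q (T (sgen i \<circ> (sgen i \<circ> w))) + scale (q - 1) (T (sgen i \<circ> w))"
    using assms v by (intro T_mult_down) (simp_all add: perm_length_eq card_inversions_ascent)
  then show ?thesis by simp
qed

text \<open>
  The unit has to be identified from the relations. For \<open>n \<ge> 2\<close> the quadratic relation, multiplied
  by \<open>T id\<close> from the left, shows that \<open>T id\<close> is idempotent up to the factor \<open>q \<noteq> 0\<close>, and then \<open>T id\<close> is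
  a left unit on the whole basis. (For \<open>n = 1\<close> the relations are void and leave the scalar open.)
\<close>

lemma T_id:
  assumes "q \<noteq> 0" "n \<ge> 2"
  shows "T id = 1"
proof -
  obtain s where s_def: "s = sgen 1" by blast
  have 1: "1 \<in> {1..<n}" using assms(2) by auto
  have asc: "ascent id 1" by (simp add: ascent_def)
  have l: "T id * T s = T s" using T_ascent[OF Sym_id 1 asc] by (simp add: s_def)
  have ss: "T s * T s = scale q (T id) + scale (q - 1) (T s)"
    using T_ascent_quadratic[OF Sym_id 1 asc] by (simp add: s_def)
  have "T id * (T s * T s) = T s * T s"
    unfolding mult.assoc[symmetric] l ..
  then have "scale q (T id * T id) = scale q (T id)"
    by (simp add: ss distrib_left scale_mult_right l)
  then have idem: "T id * T id = T id"
    using assms(1) by simp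
  have left: "T id * T w = T w" if "w \<in> Sym n" for w
    using that
  proof (induction rule: Sym_ascent_induct)
    case id show ?case by (rule idem)
  next
    case (ascent w i)
    then show ?case by (metis T_ascent mult.assoc)
  qed
  have "T id * h = h" if "h \<in> span (T ` Sym n)" for h
    using that
  proof (induction rule: span_induct_alt)
    case base show ?case by simp
  next
    case (step c x y)
    then show ?case using left by (metis distrib_left imageE scale_mult_right)
  qed
  then have "T id * 1 = 1" using T_span by blast
  then show ?thesis by simp
qed

end

section \<open>Words and coset sums\<close>

text \<open>
  With \<open>r\<close> the row index function of a composition, this is a right coset of the row stabilizer, or
  empty. For \<open>c = r\<close> it is the row stabilizer itself.
\<close>

definition perms_of_word :: "nat \<Rightarrow> (nat \<Rightarrow> nat) \<Rightarrow> (nat \<Rightarrow> nat) \<Rightarrow> (nat \<Rightarrow> nat) set" where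
  "perms_of_word n r c = {w \<in> Sym n. \<forall>x\<in>{1..n}. c (w x) = r x}"

text \<open>
  The distinguished (shortest) representatives of the cosets above.
\<close>

definition row_increasing :: "nat \<Rightarrow> (nat \<Rightarrow> nat) \<Rightarrow> (nat \<Rightarrow> nat) \<Rightarrow> bool" where
  "row_increasing n r w \<longleftrightarrow> (\<forall>x\<in>{1..n}. \<forall>y\<in>{1..n}. x < y \<longrightarrow> r x = r y \<longrightarrow> w x < w y)"

lemma Sym_inv_in: "w \<in> Sym n \<Longrightarrow> x \<in> {1..n} \<Longrightarrow> inv w x \<in> {1..n}"
  by (rule Sym_in[OF Sym_inv, THEN iffD2])

lemma finite_perms_of_word [simp]: "finite (perms_of_word n r c)"
  by (rule finite_subset[OF _ finite_Sym]) (auto simp: perms_of_word_def)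

lemma perms_of_word_cong:
  assumes "\<And>x. x \<in> {1..n} \<Longrightarrow> c x = c' x"
  shows "perms_of_word n r c = perms_of_word n r c'"
proof -
  have "c (w x) = c' (w x)" if "w \<in> Sym n" "x \<in> {1..n}" for w x
    using assms[of "w x"] Sym_in[OF that(1), of x] that(2) by simp
  then show ?thesis unfolding perms_of_word_def by auto
qed

lemma perms_of_word_inv:
  assumes "w \<in> perms_of_word n r c" "x \<in> {1..n}" shows "r (inv w x) = c x"
proof -
  have "w \<in> Sym n" using assms by (simp add: perms_of_word_def)
  then have "inv w x \<in> {1..n}" and "w (inv w x) = x"
    by (rule Sym_inv_in[OF _ assms(2)], rule Sym_inverses(2))
  moreover have "c (w (inv w x)) = r (inv w x)"
    using assms(1) \<open>inv w x \<in> {1..n}\<close> unfolding perms_of_word_def by blast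
  ultimately show ?thesis by simp
qed

lemma perms_of_word_iff:
  "w \<in> perms_of_word n r c \<longleftrightarrow> w \<in> Sym n \<and> (\<forall>x\<in>{1..n}. r (inv w x) = c x)"
proof -
  have "w \<in> perms_of_word n r c" if w: "w \<in> Sym n" and a: "\<forall>x\<in>{1..n}. r (inv w x) = c x"
  proof -
    have "c (w x) = r x" if x: "x \<in> {1..n}" for x
      using a Sym_in[OF w, of x] Sym_inverses(1)[OF w, of x] x by metis
    then show ?thesis using w by (simp add: perms_of_word_def)
  qed
  then show ?thesis using perms_of_word_inv unfolding perms_of_word_def by blast
qed

lemma sgen_in: "i \<in> {1..<n} \<Longrightarrow> sgen i x \<in> {1..n} \<longleftrightarrow> x \<in> {1..n}"
  using Sym_in[OF sgen_Sym] .

lemma in_range_Suc: "i \<in> {1..<n} \<Longrightarrow> i \<in> {1..n} \<and> Suc i \<in> {1..n}"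
  by auto

lemma perms_of_word_sgen:
  assumes i: "i \<in> {1..<n}"
  shows "perms_of_word n r (c \<circ> sgen i) = (\<circ>) (sgen i) ` perms_of_word n r c"
proof -
  have *: "sgen i \<circ> w \<in> perms_of_word n r (c \<circ> sgen i)" if "w \<in> perms_of_word n r c" for c w
  proof -
    have w: "w \<in> Sym n" "\<forall>x\<in>{1..n}. c (w x) = r x" using that by (auto simp: perms_of_word_def)
    have "sgen i \<circ> w \<in> Sym n" using Sym_comp[OF sgen_Sym[OF i] w(1)] .
    then show ?thesis using w(2) by (simp add: perms_of_word_def)
  qed
  have "w = sgen i \<circ> (sgen i \<circ> w) \<and> sgen i \<circ> w \<in> perms_of_word n r c"
    if "w \<in> perms_of_word n r (c \<circ> sgen i)" for w
  proof -
    have "(c \<circ> sgen i) \<circ> sgen i = c" by (simp add: fun_eq_iff)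
    then show ?thesis using *[OF that] by simp
  qed
  then show ?thesis using * by blast
qed

lemma inj_comp_sgen: "inj_on ((\<circ>) (sgen i)) A"
  by (rule inj_onI) (metis sgen_comp_sgen)

lemma row_increasing_sgen_comp_down:
  assumes w: "w \<in> Sym n" and a: "ascent w i" and ri: "row_increasing n r (sgen i \<circ> w)"
  shows "row_increasing n r w"
  unfolding row_increasing_def
proof (intro ballI impI)
  fix x y assume xy: "x \<in> {1..n}" "y \<in> {1..n}" "x < y" "r x = r y"
  then have lt: "sgen i (w x) < sgen i (w y)" using ri by (auto simp: row_increasing_def)
  have ne: "w x \<noteq> w y" using xy Sym_eq_iff[OF w] by simp
  have n1: "\<not> (w x = Suc i \<and> w y = i)"
  proof
    assume "w x = Suc i \<and> w y = i"
    then have "inv w (Suc i) = x" "inv w i = y" using Sym_inverses(1)[OF w] by metis+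
    then show False using a xy(3) by (simp add: ascent_def)
  qed
  have n2: "\<not> (w x = i \<and> w y = Suc i)" using lt by auto
  show "w x < w y" using sgen_less_iff[OF ne n2 n1] lt by blast
qed

lemma ascent_row_less:
  assumes w: "w \<in> Sym n" and i: "i \<in> {1..<n}" and a: "ascent w i"
    and mono: "mono_on {1..n} r" and ri: "row_increasing n r (sgen i \<circ> w)"
  shows "r (inv w i) < r (inv w (Suc i))"
proof -
  obtain x y where x: "x = inv w i" and y: "y = inv w (Suc i)" by blast
  have xy: "w x = i" "w y = Suc i" by (simp_all add: x y Sym_inverses[OF w])
  have in1: "x \<in> {1..n}" "y \<in> {1..n}"
    using i Sym_in[OF w, of x] Sym_in[OF w, of y] by (auto simp: xy)
  have lt: "x < y" using a by (simp add: ascent_def x y)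
  have "r x \<le> r y" using mono in1 lt by (auto simp: mono_on_def)
  moreover have "r x \<noteq> r y"
  proof
    assume "r x = r y"
    then have "(sgen i \<circ> w) x < (sgen i \<circ> w) y"
      using ri in1 lt unfolding row_increasing_def by blast
    then show False by (simp add: xy)
  qed
  ultimately show ?thesis by (simp add: x y)
qed

text \<open>
  Sorting a row increasing permutation never exchanges two values from the same row, so all
  permutations met on the way are row increasing as well.
\<close>

lemma row_increasing_induct [consumes 3, case_names id ascent]:
  assumes "w \<in> Sym n" "row_increasing n r w" "mono_on {1..n} r"
    and "P id"
    and "\<And>w i. w \<in> Sym n \<Longrightarrow> i \<in> {1..<n} \<Longrightarrow> row_increasing n r w \<Longrightarrow> ascent w i \<Longrightarrow>
      r (inv w i) < r (inv w (Suc i)) \<Longrightarrow> P w \<Longrightarrow> P (sgen i \<circ> w)"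
  shows "P w"
  using assms(1,2)
proof (induction rule: Sym_ascent_induct)
  case id show ?case by (rule assms(4))
next
  case (ascent w i)
  have "row_increasing n r w"
    using row_increasing_sgen_comp_down[OF ascent.hyps(1,3) ascent.prems] .
  then show ?case
    using assms(5)[OF ascent.hyps(1,2) _ ascent.hyps(3)] ascent.IH
      ascent_row_less[OF ascent.hyps assms(3) ascent.prems] by blast
qed

text \<open>
  Maximising \<open>\<Sum>x. x * w x\<close> produces a row increasing element: by the rearrangement inequality,
  undoing an inversion within a row would increase the sum further. With this potential an arbitrary
  transposition can be used, where counting inversions would require adjacent ones.
\<close>

lemma exists_row_increasing:
  assumes V: "V \<subseteq> Sym n" "V \<noteq> {}"
    and closed: "\<And>w x y. w \<in> V \<Longrightarrow> x \<in> {1..n} \<Longrightarrow> y \<in> {1..n} \<Longrightarrow> r x = r y \<Longrightarrow> w \<circ> transpose x y \<in> V"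
  shows "\<exists>w\<in>V. row_increasing n r w"
proof -
  define f where "f w = (\<Sum>x\<in>{1..n}. x * w x)" for w :: "nat \<Rightarrow> nat"
  have fin: "finite V" using V finite_Sym finite_subset by blast
  have "Max (f ` V) \<in> f ` V" using fin V by simp
  then obtain w where w: "w \<in> V" and m: "f w = Max (f ` V)" by auto
  have max: "f v \<le> f w" if "v \<in> V" for v using that fin m by simp
  have "w x < w y" if x: "x \<in> {1..n}" and y: "y \<in> {1..n}" and lt: "x < y" and r: "r x = r y" for x y
  proof (rule ccontr)
    assume "\<not> w x < w y"
    moreover have "w x \<noteq> w y" using V w lt Sym_eq_iff[of w n x y] by auto
    ultimately have gt: "w y < w x" by simp
    let ?v = "w \<circ> transpose x y"
    have split: "f u = (\<Sum>z\<in>{1..n} - {x, y}. z * u z) + (x * u x + y * u y)" for u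
    proof -
      have "{1..n} = ({1..n} - {x, y}) \<union> {x, y}" using x y by auto
      then have "f u = (\<Sum>z\<in>({1..n} - {x, y}) \<union> {x, y}. z * u z)" by (simp only: f_def)
      also have "\<dots> = (\<Sum>z\<in>{1..n} - {x, y}. z * u z) + (\<Sum>z\<in>{x, y}. z * u z)"
        by (rule sum.union_disjoint) auto
      finally show ?thesis using lt by simp
    qed
    have same: "(\<Sum>z\<in>{1..n} - {x, y}. z * ?v z) = (\<Sum>z\<in>{1..n} - {x, y}. z * w z)"
      by (rule sum.cong) (auto simp: transpose_def)
    obtain e where e: "w x = w y + Suc e" using gt by (metis less_iff_Suc_add add_Suc_right)
    obtain g where g: "y = x + Suc g" using lt by (metis less_iff_Suc_add add_Suc_right)
    have "x * w x + y * w y < x * w y + y * w x"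
      unfolding e unfolding g by (simp add: algebra_simps)
    then have "f w < f ?v" unfolding split[of w] split[of ?v] same by simp
    then show False using max[OF closed[OF w x y r]] by simp
  qed
  then have "row_increasing n r w" unfolding row_increasing_def by blast
  then show ?thesis using w by blast
qed

context hecke_algebra
begin

text \<open>
  The element \<open>[c]\<close> of the permutation module; these elements behave like words on which the Hecke
  algebra acts by exchanging neighbouring letters.
\<close>

definition word_sum :: "(nat \<Rightarrow> nat) \<Rightarrow> (nat \<Rightarrow> nat) \<Rightarrow> 'h" where
  "word_sum r c = (\<Sum>w\<in>perms_of_word n r c. T w)"

lemma word_sum_cong:
  "(\<And>x. x \<in> {1..n} \<Longrightarrow> c x = c' x) \<Longrightarrow> word_sum r c = word_sum r c'"
  unfolding word_sum_def using perms_of_word_cong[of n c c'] by simp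

text \<open>
  As \<open>r\<close> is nondecreasing, \<open>c i < c (i+1)\<close> forces \<open>i\<close> to precede \<open>i + 1\<close> in every member of the coset.
\<close>

lemma word_sum_ascent:
  assumes mono: "mono_on {1..n} r" and i: "i \<in> {1..<n}" and c: "c i < c (Suc i)"
  shows "word_sum r c * T (sgen i) = word_sum r (c \<circ> sgen i)"
proof -
  have "ascent w i" if w: "w \<in> perms_of_word n r c" for w
  proof -
    have "w \<in> Sym n" using w by (simp add: perms_of_word_def)
    then have "inv w i \<in> {1..n}" "inv w (Suc i) \<in> {1..n}"
      using in_range_Suc[OF i] Sym_inv_in by blast+
    moreover have "r (inv w i) < r (inv w (Suc i))"
      using c in_range_Suc[OF i] perms_of_word_inv[OF w] by auto
    ultimately show ?thesis unfolding ascent_def using mono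
      by (meson linorder_not_less mono_onD)
  qed
  then have "word_sum r c * T (sgen i) = (\<Sum>w\<in>perms_of_word n r c. T (sgen i \<circ> w))"
    unfolding word_sum_def sum_distrib_right
    by (intro sum.cong refl T_ascent i) (auto simp: perms_of_word_def)
  also have "\<dots> = word_sum r (c \<circ> sgen i)"
    unfolding word_sum_def perms_of_word_sgen[OF i]
    by (simp add: sum.reindex[OF inj_comp_sgen])
  finally show ?thesis .
qed

text \<open>
  The coset is a disjoint union of pairs \<open>{w, w s\<^sub>i}\<close>, and each \<open>T w + T (w s\<^sub>i)\<close> is an eigenvector of
  \<open>T\<^sub>i\<close> for the eigenvalue \<open>q\<close>.
\<close>

lemma word_sum_equal:
  assumes i: "i \<in> {1..<n}" and c: "c i = c (Suc i)"
  shows "word_sum r c * T (sgen i) = scale q (word_sum r c)"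
proof -
  \<comment> \<open>The shorter and the longer members of the pairs.\<close>
  define U where "U = {w \<in> perms_of_word n r c. ascent w i}"
  define D where "D = {w \<in> perms_of_word n r c. \<not> ascent w i}"
  have cc: "c \<circ> sgen i = c"
    using c by (auto simp: fun_eq_iff sgen_def transpose_def)
  have closed: "sgen i \<circ> w \<in> perms_of_word n r c" if "w \<in> perms_of_word n r c" for w
    using perms_of_word_sgen[OF i, of r c] that unfolding cc by blast
  have Sym: "w \<in> Sym n" if "w \<in> perms_of_word n r c" for w
    using that by (simp add: perms_of_word_def)
  have flip: "ascent (sgen i \<circ> w) i \<longleftrightarrow> \<not> ascent w i" if "w \<in> Sym n" for w
    using not_ascent[OF that] that by (auto simp: ascent_def inv_sgen_comp)
  have D: "D = (\<circ>) (sgen i) ` U"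
  proof
    show "D \<subseteq> (\<circ>) (sgen i) ` U"
    proof
      fix w assume "w \<in> D"
      then have "sgen i \<circ> w \<in> U" "w = sgen i \<circ> (sgen i \<circ> w)"
        using closed flip Sym by (auto simp: U_def D_def fun_eq_iff)
      then show "w \<in> (\<circ>) (sgen i) ` U" by blast
    qed
    show "(\<circ>) (sgen i) ` U \<subseteq> D" using closed flip Sym by (auto simp: U_def D_def)
  qed
  have fin: "finite U" "finite D" by (auto simp: U_def D_def)
  have "perms_of_word n r c = U \<union> D" "U \<inter> D = {}" by (auto simp: U_def D_def)
  then have "word_sum r c = (\<Sum>w\<in>U. T w) + (\<Sum>w\<in>D. T w)"
    by (simp add: word_sum_def sum.union_disjoint fin)
  also have "(\<Sum>w\<in>D. T w) = (\<Sum>w\<in>U. T (sgen i \<circ> w))"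
    unfolding D by (simp add: sum.reindex[OF inj_comp_sgen])
  finally have ws: "word_sum r c = (\<Sum>w\<in>U. T w + T (sgen i \<circ> w))"
    by (simp add: sum.distrib)
  have "(T w + T (sgen i \<circ> w)) * T (sgen i) = scale q (T w + T (sgen i \<circ> w))" if "w \<in> U" for w
  proof -
    have w: "w \<in> Sym n" "ascent w i" using that Sym by (auto simp: U_def)
    show ?thesis
      by (simp add: distrib_right T_ascent[OF w(1) i w(2)] T_ascent_quadratic[OF w(1) i w(2)]
          scale_right_distrib scale_left_diff_distrib)
  qed
  then show ?thesis unfolding ws by (simp add: sum_distrib_right scale_sum_right)
qed

text \<open>
  Every step of \<open>row_increasing_induct\<close> exchanges two neighbouring letters in ascending order, so
  only \<open>word_sum_ascent\<close> enters.
\<close>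

lemma word_sum_times_T:
  assumes "q \<noteq> 0" "n \<ge> 2" and mono: "mono_on {1..n} r"
    and w: "w \<in> Sym n" and "row_increasing n r w"
  shows "word_sum r r * T w = word_sum r (r \<circ> inv w)"
  using w assms(5) mono
proof (induction rule: row_increasing_induct)
  case id
  have "word_sum r r * T id = word_sum r (r \<circ> inv id)" using T_id[OF assms(1,2)] by simp
  then show ?case .
next
  case (ascent w i)
  have "word_sum r r * T (sgen i \<circ> w) = word_sum r r * T w * T (sgen i)"
    by (simp add: T_ascent[OF ascent(1,2,4)] mult.assoc)
  also have "\<dots> = word_sum r ((r \<circ> inv w) \<circ> sgen i)"
    unfolding ascent.IH using ascent by (intro word_sum_ascent mono) auto
  finally have "word_sum r r * T (sgen i \<circ> w) = word_sum r (r \<circ> inv (sgen i \<circ> w))"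
    unfolding inv_sgen_comp[OF ascent(1)] comp_assoc .
  then show ?case .
qed

text \<open>
  The lengths of a distinguished representative and of an element of the row stabilizer add up. Every
  generator that occurs in \<open>u\<close> exchanges two values in one row, and there \<open>inv w\<close> is increasing.
\<close>

lemma T_times_stabilizer:
  assumes "q \<noteq> 0" "n \<ge> 2" and mono: "mono_on {1..n} r"
    and w: "w \<in> Sym n" and ri: "row_increasing n r (inv w)"
    and u: "u \<in> perms_of_word n r r"
  shows "T w * T u = T (u \<circ> w)"
proof -
  have "u \<in> Sym n" using u by (simp add: perms_of_word_def)
  then show ?thesis using u
  proof (induction rule: Sym_ascent_induct)
    case id
    have "T w * T id = T (id \<circ> w)" using T_id[OF assms(1,2)] by simp
    then show ?case .
  next
    case (ascent u i)
    let ?x = "inv u i" and ?y = "inv u (Suc i)"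
    have ii: "i \<in> {1..n}" "Suc i \<in> {1..n}" using in_range_Suc[OF ascent(2)] by auto
    have inx: "?x \<in> {1..n}" "?y \<in> {1..n}"
      using ii Sym_inv_in[OF ascent(1)] by blast+
    have lt: "?x < ?y" using ascent by (simp add: ascent_def)
    have "r ?y = r i" "r ?x = r (Suc i)"
      using perms_of_word_inv[OF ascent.prems ii(1)] perms_of_word_inv[OF ascent.prems ii(2)]
      unfolding inv_sgen_comp[OF ascent(1)] by simp_all
    moreover have "r ?x \<le> r ?y" "r i \<le> r (Suc i)"
      using mono inx lt ii by (auto simp: mono_on_def)
    ultimately have eq: "r i = r (Suc i)" "r ?x = r ?y" by auto
    have rs: "r \<circ> sgen i = r" using eq(1) by (auto simp: fun_eq_iff sgen_def transpose_def)
    have "sgen i \<circ> (sgen i \<circ> u) \<in> perms_of_word n r (r \<circ> sgen i)"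
      using perms_of_word_sgen[OF ascent(2), of r r] ascent.prems by blast
    then have "u \<in> perms_of_word n r r" by (simp add: rs)
    then have IH: "T w * T u = T (u \<circ> w)" by (rule ascent.IH)
    have "bij u" "bij w" using ascent(1) w by (auto simp: Sym_def permutes_bij)
    then have "inv (u \<circ> w) = inv w \<circ> inv u" by (simp add: o_inv_distrib)
    then have asc: "ascent (u \<circ> w) i"
      using ri inx lt eq by (auto simp: ascent_def row_increasing_def)
    have "T w * T (sgen i \<circ> u) = T w * T u * T (sgen i)"
      by (simp add: T_ascent[OF ascent(1,2,3)] mult.assoc)
    also have "\<dots> = T (sgen i \<circ> (u \<circ> w))"
      unfolding IH by (rule T_ascent[OF Sym_comp[OF ascent(1) w] ascent(2) asc])
    finally have "T w * T (sgen i \<circ> u) = T ((sgen i \<circ> u) \<circ> w)"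
      unfolding comp_assoc .
    then show ?case .
  qed
qed

text \<open>
  A set that is stable under the row stabilizer is a disjoint union of cosets. The sum over each of
  them is \<open>T w * word_sum r r\<close> for its distinguished representative \<open>w\<close>; the cosets are split off one
  at a time.
\<close>

lemma coset_closed_sum:
  assumes "q \<noteq> 0" "n \<ge> 2" and mono: "mono_on {1..n} r"
    and "D \<subseteq> Sym n" and "\<And>u w. u \<in> perms_of_word n r r \<Longrightarrow> w \<in> D \<Longrightarrow> u \<circ> w \<in> D"
  shows "\<exists>g. (\<Sum>w\<in>D. T w) = g * word_sum r r"
  using assms(4,5)
proof (induction "card D" arbitrary: D rule: less_induct)
  case less
  have fin: "finite D" using less.prems(1) finite_subset finite_Sym by blast
  show ?case
  proof (cases "D = {}")
    case True then show ?thesis by (intro exI[of _ 0]) simp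
  next
    case False
    let ?S = "perms_of_word n r r"
    have tr: "transpose x y \<in> ?S" if "x \<in> {1..n}" "y \<in> {1..n}" "r x = r y" for x y
      using that by (auto simp: perms_of_word_def Sym_def permutes_swap_id transpose_def)
    have "\<exists>v\<in>inv ` D. row_increasing n r v"
    proof (rule exists_row_increasing)
      show "inv ` D \<subseteq> Sym n" using less.prems(1) Sym_inv by blast
      show "inv ` D \<noteq> {}" using False by simp
      fix v x y assume v: "v \<in> inv ` D" and xy: "x \<in> {1..n}" "y \<in> {1..n}" "r x = r y"
      then obtain w where w: "w \<in> D" "v = inv w" by blast
      have "bij w" using w less.prems(1) by (auto simp: Sym_def permutes_bij)
      then have "inv (transpose x y \<circ> w) = v \<circ> transpose x y"
        using w by (simp add: o_inv_distrib)
      then show "v \<circ> transpose x y \<in> inv ` D" using less.prems(2)[OF tr[OF xy] w(1)] by (metis imageI)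
    qed
    then obtain w where w: "w \<in> D" and ri: "row_increasing n r (inv w)" by blast
    have wS: "w \<in> Sym n" using w less.prems(1) by blast
    \<comment> \<open>The coset of the chosen representative, to be removed from \<open>D\<close>.\<close>
    define C where "C = (\<lambda>u. u \<circ> w) ` ?S"
    have inj: "inj_on (\<lambda>u. u \<circ> w) ?S"
    proof (rule inj_onI)
      fix u u' assume "u \<circ> w = u' \<circ> w"
      then have "u (w (inv w x)) = u' (w (inv w x))" for x by (metis comp_apply)
      then show "u = u'" by (simp add: Sym_inverses(2)[OF wS] fun_eq_iff)
    qed
    have sub: "C \<subseteq> D" using less.prems(2) w by (auto simp: C_def)
    have "id \<in> ?S" by (simp add: perms_of_word_def Sym_id)
    then have "id \<circ> w \<in> C" unfolding C_def by blast
    then have wC: "w \<in> C" by simp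
    have sumC: "(\<Sum>v\<in>C. T v) = T w * word_sum r r"
      unfolding C_def word_sum_def sum_distrib_left
      by (simp add: sum.reindex[OF inj] T_times_stabilizer[OF assms(1-3) wS ri])
    have "card (D - C) < card D"
      using w wC fin by (intro psubset_card_mono) auto
    moreover have "D - C \<subseteq> Sym n" using less.prems(1) by blast
    moreover have "u \<circ> v \<in> D - C" if u: "u \<in> ?S" and v: "v \<in> D - C" for u v
    proof -
      have False if "u \<circ> v \<in> C"
      proof -
        have "u \<circ> v \<in> (\<lambda>u. u \<circ> w) ` ?S" using that unfolding C_def .
        then obtain u' where u': "u' \<in> ?S" "u \<circ> v = u' \<circ> w" by (rule imageE)
        have uS: "u \<in> Sym n" using u by (simp add: perms_of_word_def)
        have "v = (inv u \<circ> u') \<circ> w"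
          using u'(2) Sym_inverses(1)[OF uS] by (metis (no_types, lifting) comp_apply comp_assoc fun_eq_iff)
        moreover have "inv u \<circ> u' \<in> ?S"
        proof -
          have u'S: "u' \<in> Sym n" using u'(1) by (simp add: perms_of_word_def)
          show ?thesis unfolding perms_of_word_def
            using u'(1) perms_of_word_inv[OF u] Sym_comp[OF Sym_inv[OF uS] u'S] Sym_in[OF u'S]
            by (auto simp: perms_of_word_def)
        qed
        ultimately show False using v by (auto simp: C_def)
      qed
      then show ?thesis using less.prems(2) u v by blast
    qed
    ultimately obtain g where "(\<Sum>v\<in>D - C. T v) = g * word_sum r r"
      using less.hyps by blast
    moreover have "(\<Sum>v\<in>D. T v) = (\<Sum>v\<in>D - C. T v) + (\<Sum>v\<in>C. T v)"
      by (rule sum.subset_diff[OF sub fin])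
    ultimately have "(\<Sum>v\<in>D. T v) = (g + T w) * word_sum r r"
      by (simp add: sumC distrib_right)
    then show ?thesis by blast
  qed
qed

end

section \<open>Merging letters of a word\<close>

definition replace_at :: "'a set \<Rightarrow> nat \<Rightarrow> ('a \<Rightarrow> nat) \<Rightarrow> 'a \<Rightarrow> nat" where
  "replace_at X d c = (\<lambda>p. if p \<in> X then d else c p)"

definition later_pairs :: "nat \<Rightarrow> nat \<Rightarrow> (nat \<Rightarrow> nat) \<Rightarrow> nat set \<Rightarrow> (nat \<times> nat) set" where
  "later_pairs n d c X = {(x, p). x \<in> X \<and> p \<in> {1..n} \<and> c p = d \<and> x < p}"

definition choices :: "nat \<Rightarrow> nat \<Rightarrow> nat \<Rightarrow> (nat \<Rightarrow> nat) \<Rightarrow> nat set set" where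
  "choices n d k c = {X. X \<subseteq> {x \<in> {1..n}. c x = Suc d} \<and> card X = k}"

lemma inj_sgen: "inj (sgen i)"
  by (rule injI) (metis sgen_sgen)

lemma sgen_image_image [simp]: "sgen i ` sgen i ` X = X"
  by (simp add: image_image)

lemma sgen_image_choices:
  assumes i: "i \<in> {1..<n}" and X: "X \<in> choices n d k c"
  shows "sgen i ` X \<in> choices n d k (c \<circ> sgen i)"
proof -
  have "card (sgen i ` X) = card X"
    using inj_sgen card_image inj_on_subset by (metis subset_UNIV)
  moreover have "y \<in> {1..n} \<and> (c \<circ> sgen i) y = Suc d" if y: "y \<in> sgen i ` X" for y
  proof -
    obtain x where x: "x \<in> X" "y = sgen i x" using y by blast
    then have "x \<in> {1..n}" "c x = Suc d" using X by (auto simp: choices_def)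
    then show ?thesis using sgen_in[OF i, of x] by (simp add: x)
  qed
  ultimately show ?thesis using X unfolding choices_def by blast
qed

lemma choices_sgen:
  assumes i: "i \<in> {1..<n}"
  shows "choices n d k (c \<circ> sgen i) = (`) (sgen i) ` choices n d k c"
proof -
  have cc: "(c \<circ> sgen i) \<circ> sgen i = c" by (simp add: fun_eq_iff)
  have "X = sgen i ` (sgen i ` X) \<and> sgen i ` X \<in> choices n d k c"
    if "X \<in> choices n d k (c \<circ> sgen i)" for X
    using sgen_image_choices[OF i that] unfolding cc by simp
  then have "choices n d k (c \<circ> sgen i) \<subseteq> (`) (sgen i) ` choices n d k c"
    by (metis (no_types, lifting) imageI subsetI)
  moreover have "(`) (sgen i) ` choices n d k c \<subseteq> choices n d k (c \<circ> sgen i)"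
    by (rule image_subsetI) (rule sgen_image_choices[OF i])
  ultimately show ?thesis by (rule subset_antisym)
qed

lemma replace_at_sgen:
  "replace_at (sgen i ` X) d (c \<circ> sgen i) = replace_at X d c \<circ> sgen i"
proof
  fix y
  have "y \<in> sgen i ` X \<longleftrightarrow> sgen i y \<in> X"
    by (metis imageE imageI sgen_sgen)
  then show "replace_at (sgen i ` X) d (c \<circ> sgen i) y = (replace_at X d c \<circ> sgen i) y"
    by (simp add: replace_at_def)
qed

lemma finite_later_pairs: "X \<subseteq> {1..n} \<Longrightarrow> finite (later_pairs n d c X)"
  by (rule finite_subset[of _ "{1..n} \<times> {1..n}"]) (auto simp: later_pairs_def)

text \<open>
  The exchange carries pairs to pairs and can only affect the pair \<open>{i, i+1}\<close> itself. That pair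
  appears exactly when a letter \<open>d\<close> at \<open>i\<close> passes a chosen letter \<open>d + 1\<close> at \<open>i + 1\<close>; the opposite case,
  in which it would disappear, is excluded by \<open>c i < c (i+1)\<close>.
\<close>

lemma later_pairs_sgen:
  assumes i: "i \<in> {1..<n}" and X: "X \<in> choices n d k c" and c: "c i < c (Suc i)"
  shows "later_pairs n d (c \<circ> sgen i) (sgen i ` X) =
    (if c i = d \<and> Suc i \<in> X then insert (i, Suc i) else id)
      (map_prod (sgen i) (sgen i) ` later_pairs n d c X)"
proof -
  have XD: "c x = Suc d" if "x \<in> X" for x using X that by (auto simp: choices_def)
  have main: "(sgen i a, sgen i b) \<in> later_pairs n d (c \<circ> sgen i) (sgen i ` X) \<longleftrightarrow>
      (a, b) \<in> later_pairs n d c X \<or> (a = Suc i \<and> b = i \<and> c i = d \<and> Suc i \<in> X)" for a b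
  proof -
    have ins: "sgen i a \<in> sgen i ` X \<longleftrightarrow> a \<in> X" by (metis imageE imageI sgen_sgen)
    have e: "(sgen i a, sgen i b) \<in> later_pairs n d (c \<circ> sgen i) (sgen i ` X) \<longleftrightarrow>
      a \<in> X \<and> b \<in> {1..n} \<and> c b = d \<and> sgen i a < sgen i b"
      unfolding later_pairs_def using ins sgen_in[OF i, of b] by auto
    show ?thesis
    proof (cases "a = b \<or> (a = i \<and> b = Suc i) \<or> (a = Suc i \<and> b = i)")
      case True
      then consider "a = b" | "a = i" "b = Suc i" | "a = Suc i" "b = i" by blast
      then show ?thesis
      proof cases
        case 1
        then show ?thesis unfolding e by (auto simp: later_pairs_def)
      next
        case 2
        have "\<not> (i \<in> X \<and> c (Suc i) = d)" using c XD by fastforce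
        then show ?thesis unfolding e by (auto simp: later_pairs_def 2)
      next
        case 3
        then show ?thesis unfolding e using i by (auto simp: later_pairs_def)
      qed
    next
      case False
      then have "sgen i a < sgen i b \<longleftrightarrow> a < b" by (intro sgen_less_iff) auto
      then show ?thesis unfolding e using False by (auto simp: later_pairs_def)
    qed
  qed
  have surj: "\<exists>a b. z = (sgen i a, sgen i b)" for z
    by (metis sgen_sgen surj_pair)
  have "z \<in> later_pairs n d (c \<circ> sgen i) (sgen i ` X) \<longleftrightarrow>
    z \<in> map_prod (sgen i) (sgen i) ` later_pairs n d c X \<or> (z = (i, Suc i) \<and> c i = d \<and> Suc i \<in> X)" for z
  proof -
    obtain a b where z: "z = (sgen i a, sgen i b)" using surj by blast
    have 1: "z \<in> map_prod (sgen i) (sgen i) ` later_pairs n d c X \<longleftrightarrow> (a, b) \<in> later_pairs n d c X"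
    proof
      assume "z \<in> map_prod (sgen i) (sgen i) ` later_pairs n d c X"
      then obtain a' b' where ab: "(a', b') \<in> later_pairs n d c X" "z = (sgen i a', sgen i b')"
        by auto
      then have "a = a'" "b = b'" using z by (metis prod.inject sgen_sgen)+
      then show "(a, b) \<in> later_pairs n d c X" using ab by simp
    next
      assume "(a, b) \<in> later_pairs n d c X"
      from imageI[OF this, of "map_prod (sgen i) (sgen i)"]
      show "z \<in> map_prod (sgen i) (sgen i) ` later_pairs n d c X" by (simp add: z)
    qed
    have 2: "z = (i, Suc i) \<longleftrightarrow> a = Suc i \<and> b = i"
      unfolding z by (metis Pair_inject sgen_apply sgen_sgen)
    show ?thesis unfolding 1 2 unfolding z main by blast
  qed
  then show ?thesis by auto
qed

lemma card_later_pairs_sgen: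
  assumes i: "i \<in> {1..<n}" and X: "X \<in> choices n d k c" and c: "c i < c (Suc i)"
  shows "card (later_pairs n d (c \<circ> sgen i) (sgen i ` X)) =
    card (later_pairs n d c X) + (if c i = d \<and> Suc i \<in> X then 1 else 0)"
proof -
  have Xn: "X \<subseteq> {1..n}" using X by (auto simp: choices_def)
  have inj: "inj_on (map_prod (sgen i) (sgen i)) Y" for Y
    by (rule inj_on_subset[OF prod.inj_map[OF inj_sgen inj_sgen]]) simp
  have "(i, Suc i) \<notin> map_prod (sgen i) (sgen i) ` later_pairs n d c X"
  proof
    assume "(i, Suc i) \<in> map_prod (sgen i) (sgen i) ` later_pairs n d c X"
    then obtain a b where ab: "(a, b) \<in> later_pairs n d c X" "sgen i a = i" "sgen i b = Suc i" by auto
    then have "a = Suc i" "b = i" by (metis sgen_apply sgen_sgen)+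
    then show False using ab by (simp add: later_pairs_def)
  qed
  then show ?thesis unfolding later_pairs_sgen[OF i X c]
    by (simp add: card_image[OF inj] finite_later_pairs[OF Xn])
qed

context hecke_algebra
begin

text \<open>
  The image of the word \<open>c\<close> under \<open>\<psi>\<close>, in closed form.
\<close>

definition merge_word :: "(nat \<Rightarrow> nat) \<Rightarrow> nat \<Rightarrow> nat \<Rightarrow> (nat \<Rightarrow> nat) \<Rightarrow> 'h" where
  "merge_word r d k c =
    (\<Sum>X\<in>choices n d k c. scale (q ^ card (later_pairs n d c X)) (word_sum r (replace_at X d c)))"

lemma merge_word_cong:
  assumes "\<And>x. x \<in> {1..n} \<Longrightarrow> c x = c' x"
  shows "merge_word r d k c = merge_word r d k c'"
proof -
  have 1: "choices n d k c = choices n d k c'" using assms by (auto simp: choices_def)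
  have 2: "card (later_pairs n d c X) = card (later_pairs n d c' X)" for X
    unfolding later_pairs_def using assms by (auto intro!: arg_cong[of _ _ card])
  have 3: "word_sum r (replace_at X d c) = word_sum r (replace_at X d c')" for X
    by (rule word_sum_cong) (simp add: replace_at_def assms)
  show ?thesis unfolding merge_word_def 1 2 3 ..
qed

text \<open>
  The summands are matched by letting \<open>s\<^sub>i\<close> act on \<open>X\<close>. After the replacement the two neighbours still
  ascend, or both are equal to \<open>d\<close>. In the second case \<open>T\<^sub>i\<close> contributes \<open>q\<close>, which accounts for the
  new pair.
\<close>

lemma merge_word_ascent:
  assumes mono: "mono_on {1..n} r" and i: "i \<in> {1..<n}" and c: "c i < c (Suc i)"
  shows "merge_word r d k c * T (sgen i) = merge_word r d k (c \<circ> sgen i)"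
proof -
  have "scale (q ^ card (later_pairs n d c X)) (word_sum r (replace_at X d c) * T (sgen i)) =
    scale (q ^ card (later_pairs n d (c \<circ> sgen i) (sgen i ` X)))
      (word_sum r (replace_at (sgen i ` X) d (c \<circ> sgen i)))"
    if X: "X \<in> choices n d k c" for X
  proof (cases "c i = d \<and> Suc i \<in> X")
    case True
    let ?c = "replace_at X d c"
    have eq: "?c i = ?c (Suc i)" using True by (simp add: replace_at_def)
    then have "?c \<circ> sgen i = ?c" by (auto simp: fun_eq_iff sgen_def transpose_def)
    then show ?thesis
      using True by (simp add: card_later_pairs_sgen[OF i X c] replace_at_sgen word_sum_equal[of i ?c, OF i eq] mult.commute)
  next
    case False
    have XD: "c x = Suc d" if "x \<in> X" for x using X that by (auto simp: choices_def)
    have "replace_at X d c i < replace_at X d c (Suc i)"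
      using False c XD[of i] XD[of "Suc i"] by (auto simp: replace_at_def)
    moreover have "card (later_pairs n d (c \<circ> sgen i) (sgen i ` X)) = card (later_pairs n d c X)"
      using False card_later_pairs_sgen[OF i X c] by simp
    ultimately show ?thesis
      by (simp add: replace_at_sgen word_sum_ascent[OF mono i])
  qed
  moreover have "inj_on ((`) (sgen i)) Z" for Z
    by (rule inj_onI) (metis sgen_image_image)
  ultimately show ?thesis
    unfolding merge_word_def choices_sgen[OF i]
    by (simp add: sum.reindex sum_distrib_right scale_mult_left)
qed

lemma merge_word_times_T:
  assumes "q \<noteq> 0" "n \<ge> 2" and mono: "mono_on {1..n} r" and mono': "mono_on {1..n} r'"
    and w: "w \<in> Sym n" and "row_increasing n r w"
  shows "merge_word r' d k r * T w = merge_word r' d k (r \<circ> inv w)"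
  using w assms(6) mono
proof (induction rule: row_increasing_induct)
  case id
  have "merge_word r' d k r * T id = merge_word r' d k (r \<circ> inv id)"
    using T_id[OF assms(1,2)] by simp
  then show ?case .
next
  case (ascent w i)
  have "merge_word r' d k r * T (sgen i \<circ> w) = merge_word r' d k r * T w * T (sgen i)"
    by (simp add: T_ascent[OF ascent(1,2,4)] mult.assoc)
  also have "\<dots> = merge_word r' d k ((r \<circ> inv w) \<circ> sgen i)"
    unfolding ascent.IH using ascent by (intro merge_word_ascent mono') auto
  finally have "merge_word r' d k r * T (sgen i \<circ> w) = merge_word r' d k (r \<circ> inv (sgen i \<circ> w))"
    unfolding inv_sgen_comp[OF ascent(1)] comp_assoc .
  then show ?case .
qed

end

section \<open>Gaussian polynomials as generating functions of subsets\<close>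

fun gauss_pascal :: "nat \<Rightarrow> nat \<Rightarrow> int poly" where
  "gauss_pascal a 0 = 1"
| "gauss_pascal 0 (Suc b) = 0"
| "gauss_pascal (Suc a) (Suc b) = gauss_pascal a b + monom 1 (Suc b) * gauss_pascal a (Suc b)"

lemma gauss_pascal_eq_0: "a < b \<Longrightarrow> gauss_pascal a b = 0"
  by (induction a b rule: gauss_pascal.induct) auto

lemma qnum_add: "qnum (b + a) = qnum b + monom 1 b * qnum a"
  unfolding qnum_def by (induction a) (simp_all add: mult_monom algebra_simps)

lemma qfact_Suc: "qfact (Suc a) = qfact a * qnum (Suc a)"
  by (simp add: qfact_def)

lemma qfact_0: "qfact 0 = 1"
  by (simp add: qfact_def)

lemma qfact_nonzero: "qfact a \<noteq> 0"
proof -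
  have "poly (qnum k) 1 = int k" for k
    by (simp add: qnum_def poly_sum poly_monom)
  then have "poly (qfact a) 1 = (\<Prod>k=1..a. int k)"
    by (simp add: qfact_def poly_prod)
  also have "\<dots> \<noteq> 0" by simp
  finally show ?thesis by auto
qed

text \<open>
  This identity of integer polynomials shows that the division in \<open>gauss_poly\<close> is exact, so that it
  may be replaced by the Pascal recursion before passing to the field, where quantum factorials may
  vanish.
\<close>

lemma gauss_pascal_qfact:
  "b \<le> a \<Longrightarrow> gauss_pascal a b * (qfact b * qfact (a - b)) = qfact a"
proof (induction a b rule: gauss_pascal.induct)
  case (3 a b)
  show ?case
  proof (cases "b = a")
    case True
    then show ?thesis using 3 by (simp add: gauss_pascal_eq_0 qfact_Suc qfact_0 qfact_nonzero)
  next
    case False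
    then have b: "Suc b \<le> a" using 3 by simp
    define e where "e = a - Suc b"
    have ab: "a - b = Suc e" and a: "a = Suc b + e" using b by (auto simp: e_def)
    have 1: "gauss_pascal a b * (qfact b * qfact (Suc e)) = qfact a"
      using 3(1) b by (simp add: ab)
    have 2: "gauss_pascal a (Suc b) * (qfact (Suc b) * qfact e) = qfact a"
      using 3(2) b by (simp add: e_def)
    have "gauss_pascal (Suc a) (Suc b) * (qfact (Suc b) * qfact (Suc a - Suc b)) =
      gauss_pascal a b * (qfact b * qfact (Suc e)) * qnum (Suc b) +
      monom 1 (Suc b) * (gauss_pascal a (Suc b) * (qfact (Suc b) * qfact e)) * qnum (Suc e)"
      by (simp add: ab qfact_Suc algebra_simps)
    also have "\<dots> = qfact a * (qnum (Suc b) + monom 1 (Suc b) * qnum (Suc e))"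
      unfolding 1 2 by (simp add: algebra_simps)
    also have "qnum (Suc b) + monom 1 (Suc b) * qnum (Suc e) = qnum (Suc a)"
      unfolding qnum_add[symmetric] by (simp add: a)
    finally show ?thesis by (simp add: qfact_Suc)
  qed
qed (auto simp: qfact_0)

lemma gauss_poly_eq: 
  assumes "b \<le> a" shows "gauss_poly a b = gauss_pascal a b"
proof -
  have "qfact b * qfact (a - b) \<noteq> 0" by (simp add: qfact_nonzero)
  then show ?thesis unfolding gauss_poly_def gauss_pascal_qfact[OF assms, symmetric]
    by (rule nonzero_mult_div_cancel_right)
qed

lemma map_poly_of_int_add:
  "map_poly (of_int :: int \<Rightarrow> 'f::comm_ring_1) (p + r) = map_poly of_int p + map_poly of_int r"
  by (rule poly_eqI) (simp add: coeff_map_poly)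

lemma map_poly_of_int_monom_mult:
  "map_poly (of_int :: int \<Rightarrow> 'f::comm_ring_1) (monom 1 b * p) = monom 1 b * map_poly of_int p"
  by (rule poly_eqI) (simp add: coeff_map_poly coeff_monom_mult)

text \<open>
  Both sides satisfy the same recursion: if the largest element of \<open>D\<close> belongs to \<open>X\<close>, then no
  pair involves it, and otherwise it forms a pair with each of the \<open>b\<close> elements of \<open>X\<close>.
\<close>

lemma sum_subsets_gauss_pascal:
  fixes q :: "'f::field" and D :: "nat set"
  assumes "finite D"
  shows "(\<Sum>X | X \<subseteq> D \<and> card X = b. q ^ card {(x, p). x \<in> X \<and> p \<in> D - X \<and> x < p}) =
    poly (map_poly of_int (gauss_pascal (card D) b)) q"
  using assms
proof (induction D arbitrary: b rule: finite_linorder_max_induct)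
  case empty
  have e: "{X :: nat set. X \<subseteq> {} \<and> card X = b} = (if b = 0 then {{}} else {})" by auto
  show ?case unfolding e by (cases b) auto
next
  case (insert m D)
  define f where "f D X = q ^ card {(x, p). x \<in> X \<and> p \<in> D - X \<and> x < p}" for D X :: "nat set"
  have IH: "(\<Sum>X | X \<subseteq> D \<and> card X = b. f D X) = poly (map_poly of_int (gauss_pascal (card D) b)) q" for b
    unfolding f_def by (rule insert.IH)
  have mD: "m \<notin> D" using insert.hyps(2) by blast
  have finX: "finite X" if "X \<subseteq> D" for X using that insert.hyps(1) finite_subset by blast
  show ?case
  proof (cases b)
    case 0
    have "{X. X \<subseteq> insert m D \<and> card X = 0} = {{}}"
    proof -
      have "X = {}" if "X \<subseteq> insert m D" "card X = 0" for X
        using that insert.hyps(1) finite_subset[of X "insert m D"] by simp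
      then show ?thesis by auto
    qed
    then show ?thesis by (simp add: 0)
  next
    case (Suc b')
    define A where "A = {X. X \<subseteq> D \<and> card X = Suc b'}"
    define B where "B = {X. X \<subseteq> D \<and> card X = b'}"
    have finAB: "finite A" "finite B"
      using insert.hyps(1) by (auto simp: A_def B_def)
    have split: "{X. X \<subseteq> insert m D \<and> card X = Suc b'} = A \<union> Set.insert m ` B"
    proof (intro subset_antisym subsetI)
      fix X assume "X \<in> {X. X \<subseteq> insert m D \<and> card X = Suc b'}"
      then have X: "X \<subseteq> insert m D" "card X = Suc b'" by auto
      show "X \<in> A \<union> insert m ` B"
      proof (cases "m \<in> X")
        case True
        then have "X = insert m (X - {m})" "X - {m} \<subseteq> D" "card (X - {m}) = b'"
          using X by auto
        then show ?thesis unfolding B_def by blast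
      next
        case False then show ?thesis using X by (auto simp: A_def)
      qed
    next
      fix X assume "X \<in> A \<union> insert m ` B"
      then show "X \<in> {X. X \<subseteq> insert m D \<and> card X = Suc b'}"
        using mD finX by (fastforce simp: A_def B_def card_insert_if)
    qed
    have disj: "A \<inter> insert m ` B = {}" using mD by (auto simp: A_def)
    have inj: "inj_on (insert m) B"
      using mD by (intro inj_onI) (auto simp: B_def)
    have fA: "f (insert m D) X = q ^ Suc b' * f D X" if X: "X \<in> A" for X
    proof -
      have XD: "X \<subseteq> D" "card X = Suc b'" using X by (auto simp: A_def)
      let ?P = "{(x, p). x \<in> X \<and> p \<in> D - X \<and> x < p}"
      have "{(x, p). x \<in> X \<and> p \<in> insert m D - X \<and> x < p} = ?P \<union> (\<lambda>x. (x, m)) ` X"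
        using XD(1) mD insert.hyps(2) by auto
      moreover have "finite ?P"
        by (rule finite_subset[of _ "D \<times> D"]) (use XD(1) insert.hyps(1) in auto)
      moreover have "?P \<inter> (\<lambda>x. (x, m)) ` X = {}" using mD by auto
      moreover have "card ((\<lambda>x. (x, m)) ` X) = Suc b'"
        using XD(2) by (subst card_image) (auto simp: inj_on_def)
      ultimately show ?thesis
        using finX[OF XD(1)] by (simp add: f_def card_Un_disjoint power_add mult.commute)
    qed
    have fB: "f (insert m D) (insert m X) = f D X" if X: "X \<in> B" for X
    proof -
      have XD: "X \<subseteq> D" using X by (auto simp: B_def)
      have "{(x, p). x \<in> insert m X \<and> p \<in> insert m D - insert m X \<and> x < p} =
          {(x, p). x \<in> X \<and> p \<in> D - X \<and> x < p}"
        using XD mD insert.hyps(2) by (auto dest: order.asym)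
      then show ?thesis by (simp add: f_def)
    qed
    have "(\<Sum>X | X \<subseteq> insert m D \<and> card X = Suc b'. f (insert m D) X) =
      (\<Sum>X\<in>A. f (insert m D) X) + (\<Sum>X\<in>B. f (insert m D) (insert m X))"
      unfolding split using finAB disj by (simp add: sum.union_disjoint sum.reindex[OF inj])
    also have "\<dots> = q ^ Suc b' * (\<Sum>X\<in>A. f D X) + (\<Sum>X\<in>B. f D X)"
      by (simp only: fA fB sum_distrib_left cong: sum.cong)
    also have "\<dots> = poly (map_poly of_int (gauss_pascal (card (insert m D)) (Suc b'))) q"
      using IH[of "Suc b'"] IH[of b'] mD insert.hyps(1)
      by (simp add: A_def B_def map_poly_of_int_add map_poly_of_int_monom_mult poly_monom)
    finally show ?thesis by (simp add: f_def Suc)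
  qed
qed

lemma sum_subsets_gauss:
  fixes q :: "'f::field" and D :: "nat set"
  assumes "finite D" "b \<le> card D"
  shows "(\<Sum>X | X \<subseteq> D \<and> card X = b. q ^ card {(x, p). x \<in> X \<and> p \<in> D - X \<and> x < p}) =
    gauss q (card D) b"
  using sum_subsets_gauss_pascal[OF assms(1)] assms(2) by (simp add: gauss_def gauss_poly_eq)

section \<open>Words of tableaux\<close>

lemma diagram_Sigma: "composition n lam \<Longrightarrow> diagram lam = Sigma {i. lam i \<noteq> 0} (\<lambda>i. {1..lam i})"
  by (auto simp: diagram_def composition_def Suc_le_eq intro: gr0I)

lemma finite_diagram: "composition n lam \<Longrightarrow> finite (diagram lam)"
  unfolding diagram_Sigma by (rule finite_SigmaI) (auto simp: composition_def)

lemma card_diagram: "composition n lam \<Longrightarrow> card (diagram lam) = n"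
  unfolding diagram_Sigma by (subst card_SigmaI) (auto simp: composition_def)

lemma init_tab_less_row:
  assumes "(i, j) \<in> diagram lam" "i < i'" "1 \<le> j'"
  shows "init_tab lam (i, j) < init_tab lam (i', j')"
proof -
  have ij: "1 \<le> i" "j \<le> lam i" using assms by (auto simp: diagram_def)
  have "(\<Sum>k\<in>{1..<i}. lam k) + lam i = (\<Sum>k\<in>{1..<Suc i}. lam k)"
    using ij by (simp add: sum.atLeastLessThan_Suc)
  also have "\<dots> \<le> (\<Sum>k\<in>{1..<i'}. lam k)"
    using assms(2) by (intro sum_mono2) auto
  finally show ?thesis using ij assms(3) by (simp add: init_tab_def)
qed

lemma init_tab_less_iff:
  assumes "(i, j) \<in> diagram lam" "(i', j') \<in> diagram lam"
  shows "init_tab lam (i, j) < init_tab lam (i', j') \<longleftrightarrow> i < i' \<or> i = i' \<and> j < j'"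
proof -
  have j: "1 \<le> j" "1 \<le> j'" using assms by (auto simp: diagram_def)
  consider "i < i'" | "i' < i" | "i = i'" by linarith
  then show ?thesis
  proof cases
    case 1 then show ?thesis using init_tab_less_row[OF assms(1) 1 j(2)] by simp
  next
    case 2 then show ?thesis using init_tab_less_row[OF assms(2) 2 j(1)] by simp
  next
    case 3 then show ?thesis by (simp add: init_tab_def)
  qed
qed

lemma init_tab_bij:
  assumes "composition n lam" shows "bij_betw (init_tab lam) (diagram lam) {1..n}"
proof -
  have inj: "inj_on (init_tab lam) (diagram lam)"
  proof (rule inj_onI)
    fix p p' assume p: "p \<in> diagram lam" "p' \<in> diagram lam" "init_tab lam p = init_tab lam p'"
    obtain i j i' j' where [simp]: "p = (i, j)" "p' = (i', j')" by (meson surj_pair)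
    have "\<not> init_tab lam (i, j) < init_tab lam (i', j')" "\<not> init_tab lam (i', j') < init_tab lam (i, j)"
      using p by auto
    then show "p = p'" using p init_tab_less_iff[of i j lam i' j'] init_tab_less_iff[of i' j' lam i j] by auto
  qed
  have sub: "init_tab lam ` diagram lam \<subseteq> {1..n}"
  proof (rule image_subsetI)
    fix p assume "p \<in> diagram lam"
    then obtain i j where p: "p = (i, j)" "1 \<le> i" "1 \<le> j" "j \<le> lam i" by (auto simp: diagram_def)
    have fin: "finite {i. lam i \<noteq> 0}" and n: "(\<Sum>i | lam i \<noteq> 0. lam i) = n"
      using assms by (auto simp: composition_def)
    have "(\<Sum>k\<in>{1..<i}. lam k) + lam i = (\<Sum>k\<in>{1..<Suc i}. lam k)"
      using p by (simp add: sum.atLeastLessThan_Suc)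
    also have "\<dots> = (\<Sum>k\<in>{1..<Suc i} \<inter> {i. lam i \<noteq> 0}. lam k)"
      by (intro sum.mono_neutral_right) auto
    also have "\<dots> \<le> n" unfolding n[symmetric] by (intro sum_mono2 fin) auto
    finally show "init_tab lam p \<in> {1..n}" using p by (simp add: init_tab_def)
  qed
  have "card (init_tab lam ` diagram lam) = card {1..n}"
    using card_image[OF inj] card_diagram[OF assms] by simp
  then have "init_tab lam ` diagram lam = {1..n}" using sub by (intro card_subset_eq) auto
  then show ?thesis using inj by (simp add: bij_betw_def)
qed

definition box :: "(nat \<Rightarrow> nat) \<Rightarrow> nat \<Rightarrow> nat \<times> nat" where
  "box lam = inv_into (diagram lam) (init_tab lam)"

definition row_index :: "(nat \<Rightarrow> nat) \<Rightarrow> nat \<Rightarrow> nat" where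
  "row_index lam x = fst (box lam x)"

text \<open>
  The entries of a tableau, listed in the reading order given by \<open>t\<^sup>\<lambda>\<close>.
\<close>

definition word :: "(nat \<Rightarrow> nat) \<Rightarrow> (nat \<times> nat \<Rightarrow> nat) \<Rightarrow> nat \<Rightarrow> nat" where
  "word lam B x = B (box lam x)"

lemma
  assumes "composition n lam"
  shows box_bij: "bij_betw (box lam) {1..n} (diagram lam)"
    and init_tab_box: "x \<in> {1..n} \<Longrightarrow> init_tab lam (box lam x) = x"
    and box_init_tab: "p \<in> diagram lam \<Longrightarrow> box lam (init_tab lam p) = p"
    and box_in: "x \<in> {1..n} \<Longrightarrow> box lam x \<in> diagram lam"
    and init_tab_in: "p \<in> diagram lam \<Longrightarrow> init_tab lam p \<in> {1..n}"
proof -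
  note b = init_tab_bij[OF assms]
  show bb: "bij_betw (box lam) {1..n} (diagram lam)"
    unfolding box_def by (rule bij_betw_inv_into[OF b])
  show "x \<in> {1..n} \<Longrightarrow> init_tab lam (box lam x) = x"
    unfolding box_def by (rule bij_betw_inv_into_right[OF b])
  show "p \<in> diagram lam \<Longrightarrow> box lam (init_tab lam p) = p"
    unfolding box_def by (rule bij_betw_inv_into_left[OF b])
  show "x \<in> {1..n} \<Longrightarrow> box lam x \<in> diagram lam"
    using bb by (rule bij_betwE[THEN bspec])
  show "p \<in> diagram lam \<Longrightarrow> init_tab lam p \<in> {1..n}"
    using b by (rule bij_betwE[THEN bspec])
qed

lemma row_index_init_tab:
  "composition n lam \<Longrightarrow> (i, j) \<in> diagram lam \<Longrightarrow> row_index lam (init_tab lam (i, j)) = i"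
  by (simp add: row_index_def box_init_tab)

lemma mono_row_index:
  assumes "composition n lam" shows "mono_on {1..n} (row_index lam)"
proof (rule mono_onI)
  fix x y assume xy: "x \<in> {1..n}" "y \<in> {1..n}" "x \<le> y"
  obtain i j i' j' where ij: "box lam x = (i, j)" "box lam y = (i', j')" by (meson surj_pair)
  have "init_tab lam (i', j') = y" "init_tab lam (i, j) = x"
    using init_tab_box[OF assms] xy ij by metis+
  moreover have "(i, j) \<in> diagram lam" "(i', j') \<in> diagram lam" using box_in[OF assms] xy ij by metis+
  ultimately show "row_index lam x \<le> row_index lam y"
    using init_tab_less_iff[of i' j' lam i j] xy by (auto simp: row_index_def ij)
qed

lemma row_index_ge_1: "composition n lam \<Longrightarrow> x \<in> {1..n} \<Longrightarrow> 1 \<le> row_index lam x"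
  using box_in[of n lam x] by (auto simp: row_index_def diagram_def)

lemma row_entries_eq:
  assumes "composition n lam"
  shows "row_entries lam (f \<circ> init_tab lam) i = f ` {x \<in> {1..n}. row_index lam x = i}"
proof -
  have "row_entries lam (f \<circ> init_tab lam) i = f ` (init_tab lam ` {(i, j) | j. (i, j) \<in> diagram lam})"
    by (auto simp: row_entries_def)
  also have "init_tab lam ` {(i, j) | j. (i, j) \<in> diagram lam} = {x \<in> {1..n}. row_index lam x = i}"
  proof (intro subset_antisym subsetI)
    fix x assume "x \<in> init_tab lam ` {(i, j) | j. (i, j) \<in> diagram lam}"
    then show "x \<in> {x \<in> {1..n}. row_index lam x = i}"
      using init_tab_in[OF assms] row_index_init_tab[OF assms] by auto
  next
    fix x assume x: "x \<in> {x \<in> {1..n}. row_index lam x = i}"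
    then have "x = init_tab lam (i, snd (box lam x))" "(i, snd (box lam x)) \<in> diagram lam"
      using init_tab_box[OF assms, of x] box_in[OF assms, of x] by (auto simp: row_index_def)
    then show "x \<in> init_tab lam ` {(i, j) | j. (i, j) \<in> diagram lam}" by blast
  qed
  finally show ?thesis .
qed

lemma row_stabilizer_eq:
  assumes "composition n lam"
  shows "row_stabilizer n lam = perms_of_word n (row_index lam) (row_index lam)"
proof -
  let ?r = "row_index lam"
  let ?R = "\<lambda>i. {x \<in> {1..n}. ?r x = i}"
  have init: "row_entries lam (init_tab lam) i = ?R i" for i
    using row_entries_eq[OF assms, of id i] by simp
  have "(\<forall>i\<ge>1. w ` ?R i = ?R i) \<longleftrightarrow> w \<in> perms_of_word n ?r ?r" if w: "w \<in> Sym n" for w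
  proof
    assume a: "\<forall>i\<ge>1. w ` ?R i = ?R i"
    have "?r (w x) = ?r x" if x: "x \<in> {1..n}" for x
    proof -
      have "w ` ?R (?r x) = ?R (?r x)" using a row_index_ge_1[OF assms x] by blast
      moreover have "w x \<in> w ` ?R (?r x)" using x by blast
      ultimately show ?thesis by simp
    qed
    then show "w \<in> perms_of_word n ?r ?r" using w by (simp add: perms_of_word_def)
  next
    assume p: "w \<in> perms_of_word n ?r ?r"
    show "\<forall>i\<ge>1. w ` ?R i = ?R i"
    proof (intro allI impI subset_antisym subsetI)
      fix i y assume "y \<in> w ` ?R i"
      then obtain x where x: "x \<in> {1..n}" "?r x = i" "y = w x" by blast
      then show "y \<in> ?R i" using p Sym_in[OF w, of x] by (simp add: perms_of_word_def)
    next
      fix i y assume y: "y \<in> ?R i"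
      then have "inv w y \<in> ?R i" using perms_of_word_inv[OF p] Sym_inv_in[OF w] by simp
      then have "w (inv w y) \<in> w ` ?R i" by (rule imageI)
      then show "y \<in> w ` ?R i" by (simp only: Sym_inverses(2)[OF w])
    qed
  qed
  then show ?thesis unfolding row_stabilizer_def init row_entries_eq[OF assms]
    by (auto simp: perms_of_word_def)
qed

lemma row_standard_iff:
  assumes "composition n mu" and w: "w \<in> Sym n"
  shows "row_standard mu (w \<circ> init_tab mu) \<longleftrightarrow> row_increasing n (row_index mu) w"
proof
  assume rs: "row_standard mu (w \<circ> init_tab mu)"
  show "row_increasing n (row_index mu) w"
    unfolding row_increasing_def
  proof (intro ballI impI)
    fix x y assume xy: "x \<in> {1..n}" "y \<in> {1..n}" "x < y" "row_index mu x = row_index mu y"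
    define i where "i = row_index mu x"
    define j where "j = snd (box mu x)"
    define k where "k = snd (box mu y)"
    have bx: "box mu x = (i, j)" "box mu y = (i, k)" 
      using xy(4) unfolding i_def j_def k_def row_index_def by (metis prod.collapse)+
    have x: "x = init_tab mu (i, j)" and y: "y = init_tab mu (i, k)"
      using init_tab_box[OF assms(1)] xy bx by metis+
    have d: "(i, j) \<in> diagram mu" "(i, k) \<in> diagram mu"
      using box_in[OF assms(1)] xy bx by metis+
    have "j < k" using xy(3) init_tab_less_iff[OF d] unfolding x y by simp
    then have "w x \<le> w y" using rs d unfolding row_standard_def x y by auto
    moreover have "w x \<noteq> w y" using Sym_eq_iff[OF w] xy(3) by simp
    ultimately show "w x < w y" by simp
  qed
next
  assume ri: "row_increasing n (row_index mu) w"
  show "row_standard mu (w \<circ> init_tab mu)"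
    unfolding row_standard_def
  proof (intro allI impI, elim conjE)
    fix i j k assume d: "(i, j) \<in> diagram mu" "(i, k) \<in> diagram mu" and jk: "j \<le> k"
    show "(w \<circ> init_tab mu) (i, j) \<le> (w \<circ> init_tab mu) (i, k)"
    proof (cases "j = k")
      case False
      then have "init_tab mu (i, j) < init_tab mu (i, k)" using init_tab_less_iff[OF d] jk by simp
      then have "w (init_tab mu (i, j)) < w (init_tab mu (i, k))"
        using ri d init_tab_in[OF assms(1)] row_index_init_tab[OF assms(1)]
        unfolding row_increasing_def by metis
      then show ?thesis by simp
    qed simp
  qed
qed

text \<open>
  The image under \<open>w\<close> of a row is determined by the word, and an increasing enumeration of a set is
  determined by the set: \<open>w y\<close> has as many smaller elements in the image as \<open>y\<close> has in its row.
\<close>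

lemma row_increasing_unique:
  assumes w: "w \<in> perms_of_word n r c" "row_increasing n r w"
    and v: "v \<in> perms_of_word n r c" "row_increasing n r v"
  shows "w = v"
proof -
  \<comment> \<open>The set of values that every permutation in the coset takes on the row of \<open>y\<close>.\<close>
  define C where "C y = {x \<in> {1..n}. c x = r y}" for y
  have rank: "{x \<in> C y. x < u y} = u ` {z \<in> {1..n}. r z = r y \<and> z < y}"
    if u: "u \<in> perms_of_word n r c" "row_increasing n r u" and y: "y \<in> {1..n}" for u y
  proof -
    have uS: "u \<in> Sym n" using u by (simp add: perms_of_word_def)
    show ?thesis
    proof (intro subset_antisym subsetI)
      fix x assume "x \<in> {x \<in> C y. x < u y}"
      then have x: "x \<in> {1..n}" "c x = r y" "x < u y" by (auto simp: C_def)
      have z: "inv u x \<in> {1..n}" "r (inv u x) = r y" "u (inv u x) = x"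
        using Sym_inv_in[OF uS x(1)] perms_of_word_inv[OF u(1) x(1)] x(2) Sym_inverses(2)[OF uS] by auto
      have "\<not> y < inv u x" using u(2) z y x(3) unfolding row_increasing_def by fastforce
      moreover have "inv u x \<noteq> y" using z(3) x(3) by auto
      ultimately have "inv u x \<in> {z \<in> {1..n}. r z = r y \<and> z < y}" using z by auto
      then show "x \<in> u ` {z \<in> {1..n}. r z = r y \<and> z < y}" using z(3) by force
    next
      fix x assume "x \<in> u ` {z \<in> {1..n}. r z = r y \<and> z < y}"
      then obtain z where z: "z \<in> {1..n}" "r z = r y" "z < y" "x = u z" by blast
      then have "u z < u y" using u(2) y unfolding row_increasing_def by blast
      moreover have "c (u z) = r z" using u(1) z by (simp add: perms_of_word_def)
      ultimately show "x \<in> {x \<in> C y. x < u y}"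
        using z Sym_in[OF uS, of z] by (simp add: C_def)
    qed
  qed
  have le: "u' y \<le> u y"
    if u: "u \<in> perms_of_word n r c" "row_increasing n r u" 
      and u': "u' \<in> perms_of_word n r c" "row_increasing n r u'" and y: "y \<in> {1..n}" for u u' y
  proof (rule ccontr)
    assume "\<not> u' y \<le> u y"
    then have lt: "u y < u' y" by simp
    let ?Z = "{z \<in> {1..n}. r z = r y \<and> z < y}"
    have uS: "u \<in> Sym n" "u' \<in> Sym n" using u u' by (auto simp: perms_of_word_def)
    have "card {x \<in> C y. x < v y} = card ?Z" if "v \<in> perms_of_word n r c" "row_increasing n r v" for v
    proof -
      have vS: "v \<in> Sym n" using that by (simp add: perms_of_word_def)
      show ?thesis unfolding rank[OF that y]
        by (rule card_image) (rule inj_onI, simp only: Sym_eq_iff[OF vS])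
    qed
    then have eq: "card {x \<in> C y. x < u y} = card {x \<in> C y. x < u' y}" using u u' by simp
    have "u y \<in> C y" using u y Sym_in[OF uS(1), of y] by (simp add: C_def perms_of_word_def)
    then have "{x \<in> C y. x < u y} \<subset> {x \<in> C y. x < u' y}" using lt by auto
    then have "card {x \<in> C y. x < u y} < card {x \<in> C y. x < u' y}"
      by (intro psubset_card_mono) (auto simp: C_def)
    then show False using eq by simp
  qed
  have "w y = v y" for y
  proof (cases "y \<in> {1..n}")
    case True
    then show ?thesis using le w v by (meson le_antisym)
  next
    case False
    have "w permutes {1..n}" "v permutes {1..n}" using w v by (auto simp: perms_of_word_def Sym_def)
    then show ?thesis using False by (simp add: permutes_not_in)
  qed
  then show ?thesis by (rule ext)
qed

lemma perms_of_word_transpose: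
  assumes "w \<in> perms_of_word n r c" "x \<in> {1..n}" "y \<in> {1..n}" "r x = r y"
  shows "w \<circ> transpose x y \<in> perms_of_word n r c"
proof -
  have "transpose x y \<in> Sym n" using assms by (simp add: Sym_def permutes_swap_id)
  then have "w \<circ> transpose x y \<in> Sym n" using assms Sym_comp by (simp add: perms_of_word_def)
  then show ?thesis using assms by (auto simp: perms_of_word_def transpose_def)
qed

lemma card_row_index:
  assumes "composition n mu" shows "card {x \<in> {1..n}. row_index mu x = k} = mu k"
proof -
  have "{x \<in> {1..n}. row_index mu x = k} = init_tab mu ` (Pair k ` {j. (k, j) \<in> diagram mu})"
  proof -
    have "{x \<in> {1..n}. row_index mu x = k} = row_entries mu (id \<circ> init_tab mu) k"
      unfolding row_entries_eq[OF assms] by simp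
    also have "\<dots> = init_tab mu ` (Pair k ` {j. (k, j) \<in> diagram mu})"
      unfolding row_entries_def by auto
    finally show ?thesis .
  qed
  moreover have "inj_on (init_tab mu) (Pair k ` {j. (k, j) \<in> diagram mu})"
    using init_tab_bij[OF assms] unfolding bij_betw_def by (rule inj_on_subset[OF conjunct1]) auto
  ultimately have "card {x \<in> {1..n}. row_index mu x = k} = card {j. (k, j) \<in> diagram mu}"
    by (simp add: card_image inj_on_def)
  also have "{j. (k, j) \<in> diagram mu} = {1..mu k}"
    using assms by (cases "k = 0") (auto simp: diagram_def composition_def)
  finally show ?thesis by simp
qed

lemma card_word:
  assumes "composition n lam"
  shows "card {x \<in> {1..n}. P (row_index lam x) (word lam A x)} = card {p \<in> diagram lam. P (fst p) (A p)}"
proof (rule bij_betw_same_card)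
  show "bij_betw (box lam) {x \<in> {1..n}. P (row_index lam x) (word lam A x)} {p \<in> diagram lam. P (fst p) (A p)}"
    unfolding row_index_def word_def
    by (rule bij_betw_Collect[OF box_bij[OF assms]]) simp
qed

text \<open>
  The word of a tableau of type \<open>\<mu>\<close> contains the letter \<open>k\<close> as often as the word \<open>r\<close> does, so it is a
  rearrangement of \<open>r\<close> and its coset is nonempty.
\<close>

lemma exists_row_increasing_word:
  assumes lam: "composition n lam" and mu: "composition n mu" and B: "B \<in> tableaux lam mu"
  shows "\<exists>w\<in>perms_of_word n (row_index mu) (word lam B). row_increasing n (row_index mu) w"
proof (rule exists_row_increasing)
  let ?r = "row_index mu" and ?c = "word lam B"
  show "perms_of_word n ?r ?c \<subseteq> Sym n" by (auto simp: perms_of_word_def)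
  have e: "image_mset ?r (mset_set {1..n}) = image_mset ?c (mset_set {1..n})"
  proof (rule multiset_eqI)
    fix k
    have 1: "card {x \<in> {1..n}. ?c x = k} = card {p \<in> diagram lam. B p = k}"
      using card_word[OF lam, of "\<lambda>_ y. y = k" B] by simp
    have 2: "card {p \<in> diagram lam. B p = k} = mu k"
    proof (cases "k = 0")
      case True
      have "\<forall>p\<in>diagram lam. 1 \<le> B p" using B by (auto simp: tableaux_def PiE_def Pi_def)
      then have e: "{p \<in> diagram lam. B p = k} = {}" using True by fastforce
      show ?thesis unfolding e using True mu by (simp add: composition_def)
    next
      case False then show ?thesis using B by (simp add: tableaux_def)
    qed
    then show "count (image_mset ?r (mset_set {1..n})) k = count (image_mset ?c (mset_set {1..n})) k"
      unfolding count_image_mset_eq_card_vimage[OF finite_atLeastAtMost] card_row_index[OF mu] 1 2 ..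
  qed
  obtain w where w: "w permutes {1..n}" "\<forall>x\<in>{1..n}. ?r x = ?c (w x)"
    by (rule image_mset_eq_implies_permutes[OF finite_atLeastAtMost e])
  then have "w \<in> perms_of_word n ?r ?c" by (simp add: perms_of_word_def Sym_def)
  then show "perms_of_word n ?r ?c \<noteq> {}" by blast
qed (rule perms_of_word_transpose)

text \<open>
  The description of \<open>1\<^sub>B\<close> by rows says that it is the distinguished permutation with the word of \<open>B\<close>.
\<close>

lemma tab_perm_spec:
  assumes lam: "composition n lam" and mu: "composition n mu" and B: "B \<in> tableaux lam mu"
  shows "tab_perm n lam mu B \<in> perms_of_word n (row_index mu) (word lam B)"
    and "row_increasing n (row_index mu) (tab_perm n lam mu B)"
proof -
  let ?r = "row_index mu" and ?c = "word lam B"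
  define Q where "Q w \<longleftrightarrow> w \<in> Sym n \<and> row_standard mu (w \<circ> init_tab mu) \<and>
    (\<forall>p \<in> diagram lam. init_tab lam p \<in> row_entries mu (w \<circ> init_tab mu) (B p))" for w
  have Q: "Q w \<longleftrightarrow> w \<in> perms_of_word n ?r ?c \<and> row_increasing n ?r w" for w
  proof (cases "w \<in> Sym n")
    case w: True
    have 1: "init_tab lam p \<in> w ` {x \<in> {1..n}. ?r x = B p} \<longleftrightarrow> ?r (inv w (init_tab lam p)) = B p"
      if p: "p \<in> diagram lam" for p
    proof
      assume "init_tab lam p \<in> w ` {x \<in> {1..n}. ?r x = B p}"
      then obtain x where "?r x = B p" "init_tab lam p = w x" by blast
      then show "?r (inv w (init_tab lam p)) = B p" by (simp add: Sym_inverses(1)[OF w])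
    next
      assume "?r (inv w (init_tab lam p)) = B p"
      then have "inv w (init_tab lam p) \<in> {x \<in> {1..n}. ?r x = B p}"
        using Sym_inv_in[OF w init_tab_in[OF lam p]] by simp
      then have "w (inv w (init_tab lam p)) \<in> w ` {x \<in> {1..n}. ?r x = B p}" by (rule imageI)
      then show "init_tab lam p \<in> w ` {x \<in> {1..n}. ?r x = B p}" by (simp only: Sym_inverses(2)[OF w])
    qed
    have 2: "(\<forall>p\<in>diagram lam. ?r (inv w (init_tab lam p)) = B p) \<longleftrightarrow> (\<forall>x\<in>{1..n}. ?r (inv w x) = ?c x)"
    proof (intro iffI ballI)
      fix x assume a: "\<forall>p\<in>diagram lam. ?r (inv w (init_tab lam p)) = B p" and x: "x \<in> {1..n}"
      show "?r (inv w x) = ?c x"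
        using bspec[OF a box_in[OF lam x]] by (simp add: init_tab_box[OF lam x] word_def)
    next
      fix p assume a: "\<forall>x\<in>{1..n}. ?r (inv w x) = ?c x" and p: "p \<in> diagram lam"
      show "?r (inv w (init_tab lam p)) = B p"
        using bspec[OF a init_tab_in[OF lam p]] by (simp add: box_init_tab[OF lam p] word_def)
    qed
    show ?thesis unfolding Q_def row_entries_eq[OF mu] row_standard_iff[OF mu w] perms_of_word_iff
      using w 1 2 by auto
  qed (simp add: Q_def perms_of_word_def)
  obtain w where w: "w \<in> perms_of_word n ?r ?c" "row_increasing n ?r w"
    using exists_row_increasing_word[OF assms] by blast
  have "\<exists>!w. Q w" unfolding Q using w row_increasing_unique by (intro ex1I[of _ w]) blast+
  then have "Q (THE w. Q w)" by (rule theI')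
  then show "tab_perm n lam mu B \<in> perms_of_word n ?r ?c" "row_increasing n ?r (tab_perm n lam mu B)"
    unfolding tab_perm_def Q_def[symmetric] using Q by auto
qed

section \<open>The homomorphisms in terms of words\<close>

text \<open>
  Sets of boxes are relations, so row \<open>i\<close> of such a set is the image \<open>_ `` {i}\<close>. Row equivalence
  becomes equality of the numbers of boxes with a given entry in a given row.
\<close>

definition boxes :: "(nat \<Rightarrow> nat) \<Rightarrow> (nat \<times> nat \<Rightarrow> nat) \<Rightarrow> nat \<Rightarrow> (nat \<times> nat) set" where
  "boxes lam A k = {p \<in> diagram lam. A p = k}"

definition row_class :: "(nat \<Rightarrow> nat) \<Rightarrow> (nat \<Rightarrow> nat) \<Rightarrow> (nat \<times> nat \<Rightarrow> nat) \<Rightarrow> (nat \<times> nat \<Rightarrow> nat) set" where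
  "row_class lam mu A = {B. B \<in> tableaux lam mu \<and> row_equiv lam B A}"

lemma boxes_row: "boxes lam A k `` {i} = {j. (i, j) \<in> diagram lam \<and> A (i, j) = k}"
  by (auto simp: boxes_def)

lemma finite_boxes: "composition n lam \<Longrightarrow> finite (boxes lam A k)"
  unfolding boxes_def using finite_diagram by auto

lemma finite_row: "composition n lam \<Longrightarrow> finite {j. (i, j) \<in> diagram lam}"
  by (rule finite_subset[of _ "{1..lam i}"]) (auto simp: diagram_def)

lemma row_equiv_iff:
  assumes "composition n lam"
  shows "row_equiv lam A B \<longleftrightarrow> (\<forall>i k. card (boxes lam A k `` {i}) = card (boxes lam B k `` {i}))"
proof -
  have c: "count (row_mset lam A i) k = card (boxes lam A k `` {i})" for A i k
    unfolding row_mset_def count_image_mset_eq_card_vimage[OF finite_row[OF assms]] boxes_row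
    by simp
  have z: "boxes lam A k `` {0} = {}" for A k by (auto simp: boxes_def diagram_def)
  have "row_equiv lam A B \<longleftrightarrow> (\<forall>i\<ge>1. \<forall>k. card (boxes lam A k `` {i}) = card (boxes lam B k `` {i}))"
    unfolding row_equiv_def multiset_eq_iff c ..
  also have "\<dots> \<longleftrightarrow> (\<forall>i k. card (boxes lam A k `` {i}) = card (boxes lam B k `` {i}))"
    using z by (metis less_one not_le)
  finally show ?thesis .
qed

lemma card_boxes:
  assumes "composition n lam"
  shows "card (boxes lam A k) = (\<Sum>i | lam i \<noteq> 0. card (boxes lam A k `` {i}))"
proof -
  have "boxes lam A k = Sigma {i. lam i \<noteq> 0} (\<lambda>i. boxes lam A k `` {i})"
    unfolding boxes_def diagram_Sigma[OF assms] by auto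
  moreover have "card (Sigma {i. lam i \<noteq> 0} (\<lambda>i. boxes lam A k `` {i})) =
      (\<Sum>i | lam i \<noteq> 0. card (boxes lam A k `` {i}))"
    using assms finite_row[OF assms] by (intro card_SigmaI) (auto simp: composition_def boxes_row)
  ultimately show ?thesis by simp
qed

lemma tableaux_iff:
  "A \<in> tableaux lam mu \<longleftrightarrow> A \<in> diagram lam \<rightarrow>\<^sub>E {1..} \<and> (\<forall>k\<ge>1. card (boxes lam A k) = mu k)"
  by (simp add: tableaux_def boxes_def)

lemma tableaux_PiE: "A \<in> tableaux lam mu \<Longrightarrow> A \<in> diagram lam \<rightarrow>\<^sub>E {1..}"
  by (simp add: tableaux_iff)

lemma tableaux_ge_1: "A \<in> tableaux lam mu \<Longrightarrow> p \<in> diagram lam \<Longrightarrow> 1 \<le> A p"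
  using PiE_mem[OF tableaux_PiE] by fastforce

lemma tableaux_row_equiv:
  assumes "composition n lam" "A \<in> tableaux lam mu" "B \<in> diagram lam \<rightarrow>\<^sub>E {1..}" "row_equiv lam B A"
  shows "B \<in> tableaux lam mu"
  using assms(2-4) unfolding tableaux_iff row_equiv_iff[OF assms(1)] card_boxes[OF assms(1)] by simp

lemma finite_tableaux:
  assumes "composition n lam" "composition n mu" shows "finite (tableaux lam mu)"
proof (rule finite_subset)
  show "tableaux lam mu \<subseteq> diagram lam \<rightarrow>\<^sub>E {k. mu k \<noteq> 0}"
  proof
    fix A assume A: "A \<in> tableaux lam mu"
    have "mu (A p) \<noteq> 0" if p: "p \<in> diagram lam" for p
    proof -
      have "1 \<le> A p" by (rule tableaux_ge_1[OF A p])
      then have "mu (A p) = card (boxes lam A (A p))" using A by (simp add: tableaux_iff)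
      moreover have "p \<in> boxes lam A (A p)" using p by (simp add: boxes_def)
      ultimately show ?thesis using finite_boxes[OF assms(1)] card_gt_0_iff by (metis empty_iff gr_implies_not0)
    qed
    then show "A \<in> diagram lam \<rightarrow>\<^sub>E {k. mu k \<noteq> 0}" 
      using PiE_arb[OF tableaux_PiE[OF A]] by (intro PiE_I) simp_all
  qed
  show "finite (diagram lam \<rightarrow>\<^sub>E {k. mu k \<noteq> 0})"
    using assms by (intro finite_PiE finite_diagram) (auto simp: composition_def)
qed

lemma finite_row_class:
  "composition n lam \<Longrightarrow> composition n mu \<Longrightarrow> finite (row_class lam mu A)"
  by (rule finite_subset[of _ "tableaux lam mu"]) (auto simp: row_class_def finite_tableaux)

lemma boxes_row_word:
  assumes "composition n lam"
  shows "card (boxes lam A k `` {i}) = card {x \<in> {1..n}. row_index lam x = i \<and> word lam A x = k}"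
proof -
  have "{p \<in> diagram lam. fst p = i \<and> A p = k} = Pair i ` (boxes lam A k `` {i})"
    by (auto simp: boxes_row)
  then have "card {p \<in> diagram lam. fst p = i \<and> A p = k} = card (boxes lam A k `` {i})"
    by (simp add: card_image inj_on_def)
  then show ?thesis using card_word[OF assms, of "\<lambda>a b. a = i \<and> b = k" A] by simp
qed

lemma word_eq_tableau:
  assumes lam: "composition n lam" and A: "A \<in> diagram lam \<rightarrow>\<^sub>E S" and B: "B \<in> diagram lam \<rightarrow>\<^sub>E S'"
    and eq: "\<And>x. x \<in> {1..n} \<Longrightarrow> word lam A x = word lam B x"
  shows "A = B"
proof
  fix p
  show "A p = B p"
  proof (cases "p \<in> diagram lam")
    case True
    then show ?thesis using eq[OF init_tab_in[OF lam True]] by (simp add: word_def box_init_tab[OF lam])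
  next
    case False
    then show ?thesis by (simp add: PiE_arb[OF A] PiE_arb[OF B])
  qed
qed

context hecke_algebra
begin

definition row_class_sum :: "(nat \<Rightarrow> nat) \<Rightarrow> (nat \<Rightarrow> nat) \<Rightarrow> (nat \<times> nat \<Rightarrow> nat) \<Rightarrow> 'h" where
  "row_class_sum lam mu A = (\<Sum>B\<in>row_class lam mu A. word_sum (row_index mu) (word lam B))"

lemma x_elt_eq: "composition n lam \<Longrightarrow> x_elt n T lam = word_sum (row_index lam) (row_index lam)"
  by (simp add: x_elt_def word_sum_def row_stabilizer_eq)

lemma x_elt_times_tab_perm:
  assumes "q \<noteq> 0" "n \<ge> 2" and lam: "composition n lam" and mu: "composition n mu"
    and B: "B \<in> tableaux lam mu"
  shows "x_elt n T mu * T (tab_perm n lam mu B) = word_sum (row_index mu) (word lam B)"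
proof -
  note s = tab_perm_spec[OF lam mu B]
  have "tab_perm n lam mu B \<in> Sym n" using s(1) by (simp add: perms_of_word_def)
  then have "x_elt n T mu * T (tab_perm n lam mu B) =
      word_sum (row_index mu) (row_index mu \<circ> inv (tab_perm n lam mu B))"
    unfolding x_elt_eq[OF mu] by (intro word_sum_times_T assms mono_row_index s(2))
  also have "\<dots> = word_sum (row_index mu) (word lam B)"
    by (rule word_sum_cong) (simp add: perms_of_word_inv[OF s(1)])
  finally show ?thesis .
qed

text \<open>
  The permutations whose words belong to a row class form a set stable under the row stabilizer of
  \<open>\<lambda>\<close>: its elements permute the boxes within the rows of \<open>\<lambda>\<close>, which turns a tableau into a row
  equivalent one.
\<close>

lemma row_class_sum_factor:
  assumes "q \<noteq> 0" "n \<ge> 2" and lam: "composition n lam" and mu: "composition n mu"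
    and A: "A \<in> tableaux lam mu"
  shows "\<exists>g. row_class_sum lam mu A = g * x_elt n T lam"
proof -
  let ?rl = "row_index lam" and ?rm = "row_index mu"
  define P where "P B = perms_of_word n ?rm (word lam B)" for B
  \<comment> \<open>A tableau is determined by its word, so the cosets \<open>P B\<close> are disjoint.\<close>
  define D where "D = (\<Union>B\<in>row_class lam mu A. P B)"
  have inj: "P B \<inter> P B' = {}" if B: "B \<in> row_class lam mu A" "B' \<in> row_class lam mu A" "B \<noteq> B'" for B B'
  proof (rule ccontr)
    assume "P B \<inter> P B' \<noteq> {}"
    then obtain w where w: "w \<in> P B" "w \<in> P B'" by blast
    have "word lam B x = word lam B' x" if x: "x \<in> {1..n}" for x
      using perms_of_word_inv[OF w(1)[unfolded P_def] x] perms_of_word_inv[OF w(2)[unfolded P_def] x] by simp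
    then have "B = B'" using B word_eq_tableau[OF lam] by (auto simp: row_class_def tableaux_def)
    then show False using B by simp
  qed
  have "row_class_sum lam mu A = (\<Sum>w\<in>D. T w)"
    unfolding row_class_sum_def word_sum_def D_def P_def
    by (subst sum.UNION_disjoint)
      (use inj finite_row_class[OF lam mu] in \<open>auto simp: P_def\<close>)
  moreover have "\<exists>g. (\<Sum>w\<in>D. T w) = g * word_sum ?rl ?rl"
  proof (rule coset_closed_sum[OF assms(1,2) mono_row_index[OF lam]])
    show "D \<subseteq> Sym n" by (auto simp: D_def P_def perms_of_word_def)
    fix u w assume u: "u \<in> perms_of_word n ?rl ?rl" and "w \<in> D"
    then obtain B where B: "B \<in> row_class lam mu A" and w: "w \<in> P B" by (auto simp: D_def)
    have uS: "u \<in> Sym n" using u by (simp add: perms_of_word_def)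
    have wS: "w \<in> Sym n" using w by (simp add: perms_of_word_def P_def)
    \<comment> \<open>The tableau obtained from \<open>B\<close> by moving its entries along the row permutation \<open>u\<close>.\<close>
    define B' where "B' = restrict (\<lambda>p. word lam B (inv u (init_tab lam p))) (diagram lam)"
    have wB': "word lam B' x = word lam B (inv u x)" if "x \<in> {1..n}" for x
      unfolding word_def[of lam B'] unfolding B'_def
      by (simp add: box_in[OF lam that] init_tab_box[OF lam that])
    have Bx: "B \<in> diagram lam \<rightarrow>\<^sub>E {1..}" using B by (auto simp: row_class_def tableaux_iff)
    have B'x: "B' \<in> diagram lam \<rightarrow>\<^sub>E {1..}"
    proof (rule PiE_I)
      fix p assume p: "p \<in> diagram lam"
      have "box lam (inv u (init_tab lam p)) \<in> diagram lam"
        using box_in[OF lam Sym_inv_in[OF uS init_tab_in[OF lam p]]] .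
      then show "B' p \<in> {1..}" using p PiE_mem[OF Bx] by (simp add: B'_def word_def)
    qed (simp add: B'_def)
    have "row_equiv lam B' B"
      unfolding row_equiv_iff[OF lam] boxes_row_word[OF lam]
    proof (intro allI)
      fix i k
      have "bij_betw u {x \<in> {1..n}. ?rl x = i \<and> word lam B x = k} {x \<in> {1..n}. ?rl x = i \<and> word lam B' x = k}"
      proof (rule bij_betw_Collect)
        show "bij_betw u {1..n} {1..n}" using uS by (simp add: Sym_def permutes_imp_bij)
        fix x assume x: "x \<in> {1..n}"
        have "u x \<in> {1..n}" using Sym_in[OF uS, of x] x by blast
        then have "word lam B' (u x) = word lam B x" by (simp only: wB' Sym_inverses(1)[OF uS])
        then show "?rl (u x) = i \<and> word lam B' (u x) = k \<longleftrightarrow> ?rl x = i \<and> word lam B x = k"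
          using u x by (simp add: perms_of_word_def)
      qed
      then show "card {x \<in> {1..n}. ?rl x = i \<and> word lam B' x = k} = card {x \<in> {1..n}. ?rl x = i \<and> word lam B x = k}"
        by (rule bij_betw_same_card[symmetric])
    qed
    then have "row_equiv lam B' A" using B by (simp add: row_class_def row_equiv_def)
    then have B'r: "B' \<in> row_class lam mu A"
      using tableaux_row_equiv[OF lam A B'x] by (simp add: row_class_def)
    have "word lam B' ((u \<circ> w) x) = ?rm x" if x: "x \<in> {1..n}" for x
    proof -
      have "w x \<in> {1..n}" using Sym_in[OF wS, of x] x by blast
      then have "u (w x) \<in> {1..n}" using Sym_in[OF uS, of "w x"] by blast
      then have "word lam B' (u (w x)) = word lam B (w x)" by (simp only: wB' Sym_inverses(1)[OF uS])
      then show ?thesis using w x by (simp add: P_def perms_of_word_def)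
    qed
    then have "u \<circ> w \<in> P B'" using Sym_comp[OF uS wS] by (simp add: P_def perms_of_word_def)
    then show "u \<circ> w \<in> D" using B'r by (auto simp: D_def)
  qed
  ultimately show ?thesis by (simp add: x_elt_eq[OF lam])
qed

text \<open>
  An element of the permutation module may be written as \<open>x\<^sub>\<lambda> h\<close> in many ways; the factorization
  above makes the value independent of the choice, as the definite description requires.
\<close>

lemma Theta_eval:
  assumes "q \<noteq> 0" "n \<ge> 2" and lam: "composition n lam" and mu: "composition n mu"
    and A: "A \<in> tableaux lam mu"
  shows "Theta n T lam mu A (x_elt n T lam * h) = row_class_sum lam mu A * h"
proof -
  have s: "x_elt n T mu * (\<Sum>B | B \<in> tableaux lam mu \<and> row_equiv lam B A. T (tab_perm n lam mu B))
    = row_class_sum lam mu A"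
    unfolding row_class_sum_def sum_distrib_left row_class_def[symmetric]
    by (rule sum.cong) (auto simp: row_class_def x_elt_times_tab_perm[OF assms(1-4)])
  obtain g where g: "row_class_sum lam mu A = g * x_elt n T lam"
    using row_class_sum_factor[OF assms] by blast
  show ?thesis unfolding Theta_def s
  proof (rule the_equality)
    show "\<exists>h'. x_elt n T lam * h = x_elt n T lam * h' \<and> row_class_sum lam mu A * h = row_class_sum lam mu A * h'"
      by blast
    fix v assume "\<exists>h'. x_elt n T lam * h = x_elt n T lam * h' \<and> v = row_class_sum lam mu A * h'"
    then show "v = row_class_sum lam mu A * h" unfolding g by (metis mult.assoc)
  qed
qed

end

section \<open>Exchanging entries of tableaux\<close>

lemma boxes_replace:
  assumes "X \<subseteq> boxes lam A b" "a \<noteq> b"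
  shows "boxes lam (replace_at X a A) a = boxes lam A a \<union> X"
    and "boxes lam (replace_at X a A) b = boxes lam A b - X"
    and "k \<noteq> a \<Longrightarrow> k \<noteq> b \<Longrightarrow> boxes lam (replace_at X a A) k = boxes lam A k"
  using assms by (auto simp: boxes_def replace_at_def)

lemma replace_at_back:
  "X \<subseteq> boxes lam A b \<Longrightarrow> replace_at X b (replace_at X a A) = A"
  by (auto simp: boxes_def replace_at_def fun_eq_iff)

lemma replace_at_extensional:
  "X \<subseteq> boxes lam A b \<Longrightarrow> 1 \<le> a \<Longrightarrow> A \<in> diagram lam \<rightarrow>\<^sub>E {1..} \<Longrightarrow>
    replace_at X a A \<in> diagram lam \<rightarrow>\<^sub>E {1..}"
  by (fastforce simp: boxes_def replace_at_def PiE_def Pi_def extensional_def)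

lemma card_boxes_replace:
  assumes lam: "composition n lam" and X: "X \<subseteq> boxes lam A b" "a \<noteq> b"
  shows "card (boxes lam (replace_at X a A) a) = card (boxes lam A a) + card X"
    and "card (boxes lam (replace_at X a A) b) = card (boxes lam A b) - card X"
proof -
  have fin: "finite X" using X(1) finite_boxes[OF lam] finite_subset by blast
  have "boxes lam A a \<inter> X = {}" using X by (auto simp: boxes_def)
  then show "card (boxes lam (replace_at X a A) a) = card (boxes lam A a) + card X"
    unfolding boxes_replace(1)[OF X] by (simp add: card_Un_disjoint finite_boxes[OF lam] fin)
  show "card (boxes lam (replace_at X a A) b) = card (boxes lam A b) - card X"
    unfolding boxes_replace(2)[OF X] by (rule card_Diff_subset[OF fin X(1)])
qed

lemma card_row_boxes_replace:
  assumes lam: "composition n lam" and X: "X \<subseteq> boxes lam A b" "a \<noteq> b"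
  shows "card (boxes lam (replace_at X a A) k `` {i}) =
    (if k = a then card (boxes lam A a `` {i}) + card (X `` {i})
     else if k = b then card (boxes lam A b `` {i}) - card (X `` {i})
     else card (boxes lam A k `` {i}))"
proof -
  have finB: "finite (boxes lam A k `` {i})" for k
    using finite_row[OF lam] by (simp add: boxes_row)
  have sub: "X `` {i} \<subseteq> boxes lam A b `` {i}" using X by blast
  then have fin: "finite (X `` {i})" using finB finite_subset by blast
  have "boxes lam A a `` {i} \<inter> X `` {i} = {}" using X by (auto simp: boxes_def)
  then have "card ((boxes lam A a \<union> X) `` {i}) = card (boxes lam A a `` {i}) + card (X `` {i})"
    by (simp add: Un_Image card_Un_disjoint finB fin)
  moreover have "(boxes lam A b - X) `` {i} = boxes lam A b `` {i} - X `` {i}" by blast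
  ultimately show ?thesis
    using boxes_replace[OF X] card_Diff_subset[OF fin sub] X(2) by auto
qed

lemma tableaux_replace_down:
  assumes lam: "composition n lam" and A: "A \<in> tableaux lam mu" and d: "1 \<le> d" and t: "t \<le> mu (d + 1)"
    and X: "X \<subseteq> boxes lam A (Suc d)" "card X = mu (d + 1) - t"
  shows "replace_at X d A \<in> tableaux lam (nu_comp mu d t)"
proof -
  have ext: "replace_at X d A \<in> diagram lam \<rightarrow>\<^sub>E {1..}"
    using replace_at_extensional[OF X(1) d] A by (simp add: tableaux_iff)
  have c: "card (boxes lam A k) = mu k" if "1 \<le> k" for k using A that by (simp add: tableaux_iff)
  have "card (boxes lam (replace_at X d A) k) = nu_comp mu d t k" if k: "1 \<le> k" for k
    using card_boxes_replace[OF lam X(1), of d] boxes_replace(3)[OF X(1), of d k] c[OF k] c[OF d] c[of "Suc d"] X(2) t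
    by (auto simp: nu_comp_def)
  then show ?thesis using ext by (simp add: tableaux_iff)
qed

lemma tableaux_replace_up:
  assumes lam: "composition n lam" and S: "S \<in> tableaux lam (nu_comp mu d t)" and d: "1 \<le> d"
    and t: "t \<le> mu (d + 1)" and X: "X \<subseteq> boxes lam S d" "card X = mu (d + 1) - t"
  shows "replace_at X (Suc d) S \<in> tableaux lam mu"
proof -
  have ext: "replace_at X (Suc d) S \<in> diagram lam \<rightarrow>\<^sub>E {1..}"
    using replace_at_extensional[OF X(1), of "Suc d"] S by (simp add: tableaux_iff)
  have c: "card (boxes lam S k) = nu_comp mu d t k" if "1 \<le> k" for k using S that by (simp add: tableaux_iff)
  have "card (boxes lam (replace_at X (Suc d) S) k) = mu k" if k: "1 \<le> k" for k
    using card_boxes_replace[OF lam X(1), of "Suc d"] boxes_replace(3)[OF X(1), of "Suc d" k]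
      c[OF k] c[OF d] c[of "Suc d"] X(2) t
    by (cases "k = d"; cases "k = Suc d") (auto simp: nu_comp_def)
  then show ?thesis using ext by (simp add: tableaux_iff)
qed

lemma composition_nu_comp:
  assumes mu: "composition n mu" and d: "1 \<le> d" and t: "t \<le> mu (d + 1)"
  shows "composition n (nu_comp mu d t)"
proof -
  let ?nu = "nu_comp mu d t" and ?S = "insert d (insert (Suc d) {i. mu i \<noteq> 0})"
  have fin: "finite ?S" using mu by (simp add: composition_def)
  have sub: "{i. ?nu i \<noteq> 0} \<subseteq> ?S" by (auto simp: nu_comp_def)
  have split: "(\<Sum>i\<in>?S. f i) = f d + f (Suc d) + (\<Sum>i\<in>?S - {d, Suc d}. f i)" for f :: "nat \<Rightarrow> nat"
  proof -
    have "(\<Sum>i\<in>?S. f i) = (\<Sum>i\<in>{d, Suc d}. f i) + (\<Sum>i\<in>?S - {d, Suc d}. f i)"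
      using sum.subset_diff[of "{d, Suc d}" ?S f] fin by (simp add: add.commute)
    then show ?thesis by simp
  qed
  have "(\<Sum>i | ?nu i \<noteq> 0. ?nu i) = (\<Sum>i\<in>?S. ?nu i)"
    by (rule sum.mono_neutral_left[OF fin sub]) auto
  also have "\<dots> = ?nu d + ?nu (Suc d) + (\<Sum>i\<in>?S - {d, Suc d}. mu i)"
    unfolding split[of ?nu] by (intro arg_cong2[of _ _ _ _ "(+)"] refl sum.cong) (auto simp: nu_comp_def)
  also have "?nu d + ?nu (Suc d) = mu d + mu (Suc d)" using t by (simp add: nu_comp_def)
  also have "\<dots> + (\<Sum>i\<in>?S - {d, Suc d}. mu i) = (\<Sum>i\<in>?S. mu i)" by (rule split[symmetric])
  also have "\<dots> = (\<Sum>i | mu i \<noteq> 0. mu i)" by (rule sum.mono_neutral_right[OF fin]) auto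
  also have "\<dots> = n" using mu by (simp add: composition_def)
  finally show ?thesis using finite_subset[OF sub fin] mu d by (simp add: composition_def nu_comp_def)
qed

section \<open>The map \<open>\<psi>\<close> on words\<close>

definition later_boxes :: "(nat \<Rightarrow> nat) \<Rightarrow> (nat \<times> nat \<Rightarrow> nat) \<Rightarrow> nat \<Rightarrow> (nat \<times> nat) set \<Rightarrow> nat" where
  "later_boxes lam A d X =
    card {(x, p). x \<in> X \<and> p \<in> boxes lam A d \<and> init_tab lam x < init_tab lam p}"

definition box_choices :: "(nat \<Rightarrow> nat) \<Rightarrow> (nat \<times> nat \<Rightarrow> nat) \<Rightarrow> nat \<Rightarrow> nat \<Rightarrow> (nat \<times> nat) set set" where
  "box_choices lam A d k = {X. X \<subseteq> boxes lam A (Suc d) \<and> card X = k}"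

lemma choices_word:
  assumes lam: "composition n lam"
  shows "choices n d k (word lam A) = (`) (init_tab lam) ` box_choices lam A d k"
proof (intro subset_antisym subsetI)
  fix Y assume Y: "Y \<in> choices n d k (word lam A)"
  then have Yn: "Y \<subseteq> {1..n}" by (auto simp: choices_def)
  let ?X = "box lam ` Y"
  have "init_tab lam ` ?X = Y"
    unfolding image_image using Yn init_tab_box[OF lam] by (simp add: subset_iff image_iff set_eq_iff)
  moreover have "?X \<in> box_choices lam A d k"
  proof -
    have "inj_on (box lam) Y"
      using inj_on_subset[OF bij_betw_imp_inj_on[OF box_bij[OF lam]] Yn] .
    then have "card ?X = k" using Y by (simp add: card_image choices_def)
    moreover have "box lam y \<in> boxes lam A (Suc d)" if "y \<in> Y" for y
    proof -
      have "y \<in> {1..n}" "word lam A y = Suc d" using Y that by (auto simp: choices_def)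
      then show ?thesis using box_in[OF lam, of y] by (simp add: boxes_def word_def)
    qed
    ultimately show ?thesis by (auto simp: box_choices_def)
  qed
  ultimately show "Y \<in> (`) (init_tab lam) ` box_choices lam A d k" by (intro image_eqI[of _ _ ?X]) simp_all
next
  fix Y assume "Y \<in> (`) (init_tab lam) ` box_choices lam A d k"
  then obtain X where X: "X \<subseteq> boxes lam A (Suc d)" "card X = k" and Y: "Y = init_tab lam ` X"
    by (auto simp: box_choices_def)
  have Xd: "X \<subseteq> diagram lam" using X by (auto simp: boxes_def)
  then have "inj_on (init_tab lam) X"
    by (rule inj_on_subset[OF bij_betw_imp_inj_on[OF init_tab_bij[OF lam]]])
  then have "card Y = k" using X Y by (simp add: card_image)
  moreover have "init_tab lam p \<in> {1..n} \<and> word lam A (init_tab lam p) = Suc d" if p: "p \<in> X" for p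
  proof -
    have pd: "p \<in> diagram lam" using p Xd by blast
    have "A p = Suc d" using p X by (auto simp: boxes_def)
    then show ?thesis using init_tab_in[OF lam pd] by (simp add: word_def box_init_tab[OF lam pd])
  qed
  ultimately show "Y \<in> choices n d k (word lam A)" using Y by (auto simp: choices_def)
qed

lemma card_later_pairs_word:
  assumes lam: "composition n lam" and X: "X \<subseteq> diagram lam"
  shows "card (later_pairs n d (word lam A) (init_tab lam ` X)) = later_boxes lam A d X"
proof -
  let ?Q = "{(x, p). x \<in> X \<and> p \<in> boxes lam A d \<and> init_tab lam x < init_tab lam p}"
  have inj: "inj_on (init_tab lam) (diagram lam)" using init_tab_bij[OF lam] by (simp add: bij_betw_def)
  have sub: "?Q \<subseteq> diagram lam \<times> diagram lam" using X by (auto simp: boxes_def)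
  have "inj_on (map_prod (init_tab lam) (init_tab lam)) ?Q"
    by (rule inj_on_subset[OF map_prod_inj_on[OF inj inj] sub])
  moreover have "{(x, p). x \<in> init_tab lam ` X \<and> p \<in> {1..n} \<and> word lam A p = d \<and> x < p} =
      map_prod (init_tab lam) (init_tab lam) ` ?Q"
  proof (intro subset_antisym subsetI)
    fix z assume "z \<in> {(x, p). x \<in> init_tab lam ` X \<and> p \<in> {1..n} \<and> word lam A p = d \<and> x < p}"
    then obtain x p where z: "z = (init_tab lam x, p)" "x \<in> X" "p \<in> {1..n}" "word lam A p = d" "init_tab lam x < p"
      by auto
    then have "(x, box lam p) \<in> ?Q" "z = map_prod (init_tab lam) (init_tab lam) (x, box lam p)"
      using box_in[OF lam z(3)] init_tab_box[OF lam z(3)] by (auto simp: boxes_def word_def)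
    then show "z \<in> map_prod (init_tab lam) (init_tab lam) ` ?Q" by (intro image_eqI[of _ _ "(x, box lam p)"])
  next
    fix z assume "z \<in> map_prod (init_tab lam) (init_tab lam) ` ?Q"
    then obtain x p where z: "z = (init_tab lam x, init_tab lam p)" "x \<in> X" "p \<in> boxes lam A d"
      "init_tab lam x < init_tab lam p" by auto
    have pd: "p \<in> diagram lam" "A p = d" using z(3) by (auto simp: boxes_def)
    show "z \<in> {(x, p). x \<in> init_tab lam ` X \<and> p \<in> {1..n} \<and> word lam A p = d \<and> x < p}"
      using z init_tab_in[OF lam pd(1)] pd(2) by (simp add: word_def box_init_tab[OF lam pd(1)])
  qed
  ultimately show ?thesis unfolding later_pairs_def later_boxes_def by (simp add: card_image)
qed

lemma replace_at_word:
  assumes lam: "composition n lam" and X: "X \<subseteq> diagram lam" and x: "x \<in> {1..n}"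
  shows "replace_at (init_tab lam ` X) d (word lam A) x = word lam (replace_at X d A) x"
proof -
  have "x \<in> init_tab lam ` X \<longleftrightarrow> box lam x \<in> X"
  proof
    assume "x \<in> init_tab lam ` X"
    then obtain p where p: "p \<in> X" "x = init_tab lam p" by blast
    then have "p \<in> diagram lam" using X by blast
    then show "box lam x \<in> X" using p by (simp add: box_init_tab[OF lam])
  next
    assume "box lam x \<in> X"
    then have "init_tab lam (box lam x) \<in> init_tab lam ` X" by (rule imageI)
    then show "x \<in> init_tab lam ` X" by (simp only: init_tab_box[OF lam x])
  qed
  then show ?thesis by (simp add: replace_at_def word_def)
qed

text \<open>
  The only tableau of shape and type \<open>\<mu>\<close> whose word is the row index function; it stands for \<open>x\<^sub>\<mu>\<close>.
\<close>

definition row_tab :: "(nat \<Rightarrow> nat) \<Rightarrow> nat \<times> nat \<Rightarrow> nat" where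
  "row_tab mu = restrict fst (diagram mu)"

lemma boxes_row_tab: "boxes mu (row_tab mu) k = Pair k ` {j. (k, j) \<in> diagram mu}"
  by (auto simp: boxes_def row_tab_def)

lemma card_diagram_row:
  assumes "composition n mu" shows "card {j. (k, j) \<in> diagram mu} = mu k"
proof -
  have "{j. (k, j) \<in> diagram mu} = {1..mu k}"
    using assms by (cases "k = 0") (auto simp: diagram_def composition_def)
  then show ?thesis by simp
qed

lemma row_tab_tableaux:
  assumes "composition n mu" shows "row_tab mu \<in> tableaux mu mu"
  unfolding tableaux_iff
proof (intro conjI allI impI)
  show "row_tab mu \<in> diagram mu \<rightarrow>\<^sub>E {1..}" by (auto simp: row_tab_def diagram_def)
  show "card (boxes mu (row_tab mu) k) = mu k" for k
    unfolding boxes_row_tab by (simp add: card_image inj_on_def card_diagram_row[OF assms])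
qed

text \<open>
  A tableau row equivalent to \<open>psi_tab\<close> has only entries \<open>d\<close> and \<open>d + 1\<close> in row \<open>d + 1\<close> and constant
  rows elsewhere, so it is determined by the boxes of row \<open>d + 1\<close> that contain \<open>d\<close>.
\<close>

lemma row_class_psi_tab:
  assumes mu: "composition n mu" and d: "1 \<le> d" and t: "t \<le> mu (d + 1)"
  shows "bij_betw (\<lambda>X. replace_at X d (row_tab mu)) (box_choices mu (row_tab mu) d (mu (d + 1) - t))
    (row_class mu (nu_comp mu d t) (psi_tab mu d t))"
proof -
  let ?k = "mu (d + 1) - t" and ?A = "row_tab mu" and ?R = "psi_tab mu d t" and ?nu = "nu_comp mu d t"
  define Z where "Z = Pair (Suc d) ` {1..?k}"
  have Zs: "Z \<subseteq> boxes mu ?A (Suc d)" by (auto simp: Z_def boxes_row_tab diagram_def)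
  have Zc: "card Z = ?k" by (simp add: Z_def card_image inj_on_def)
  have R: "?R = replace_at Z d ?A"
    by (auto simp: psi_tab_def replace_at_def row_tab_def Z_def fun_eq_iff diagram_def)
  have rowX: "card (X `` {i}) = (if i = Suc d then card X else 0)" if "X \<subseteq> boxes mu ?A (Suc d)" for X i
  proof (cases "i = Suc d")
    case True
    have "X = Pair (Suc d) ` (X `` {Suc d})" using that by (auto simp: boxes_row_tab)
    then have "card X = card (Pair (Suc d) ` (X `` {Suc d}))" by simp
    also have "\<dots> = card (X `` {Suc d})" by (rule card_image) (simp add: inj_on_def)
    finally have "card X = card (X `` {Suc d})" .
    then show ?thesis using True by simp
  next
    case False
    then have "X `` {i} = {}" using that by (auto simp: boxes_row_tab)
    then show ?thesis using False by simp
  qed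
  have into: "replace_at X d ?A \<in> row_class mu ?nu ?R" if "X \<in> box_choices mu ?A d ?k" for X
  proof -
    have X: "X \<subseteq> boxes mu ?A (Suc d)" "card X = ?k" using that by (auto simp: box_choices_def)
    have "replace_at X d ?A \<in> tableaux mu ?nu"
      by (rule tableaux_replace_down[OF mu row_tab_tableaux[OF mu] d t X])
    moreover have "row_equiv mu (replace_at X d ?A) ?R"
      unfolding row_equiv_iff[OF mu] R
      by (simp add: card_row_boxes_replace[OF mu X(1)] card_row_boxes_replace[OF mu Zs] rowX[OF X(1)] rowX[OF Zs] X(2) Zc)
    ultimately show ?thesis by (simp add: row_class_def)
  qed
  have surj: "\<exists>X\<in>box_choices mu ?A d ?k. B = replace_at X d ?A" if B: "B \<in> row_class mu ?nu ?R" for B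
  proof -
    have Bt: "B \<in> tableaux mu ?nu" and rows: "card (boxes mu B k `` {i}) = card (boxes mu ?R k `` {i})" for i k
      using B row_equiv_iff[OF mu] by (auto simp: row_class_def)
    have vals: "B (i, j) = i \<or> (i = Suc d \<and> B (i, j) = d)" if ij: "(i, j) \<in> diagram mu" for i j
    proof -
      have "j \<in> boxes mu B (B (i, j)) `` {i}" using ij by (auto simp: boxes_def)
      moreover have "finite (boxes mu B k `` {i})" for k using finite_row[OF mu] by (simp add: boxes_row)
      ultimately have "card (boxes mu B (B (i, j)) `` {i}) \<noteq> 0" by auto
      then have "boxes mu ?R (B (i, j)) `` {i} \<noteq> {}" unfolding rows by auto
      then obtain j' where "(i, j') \<in> diagram mu" "?R (i, j') = B (i, j)" by (auto simp: boxes_def)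
      then have "B (i, j) = (if i = d + 1 \<and> j' \<le> ?k then d else i)" by (simp add: psi_tab_def)
      then show ?thesis by (cases "i = d + 1 \<and> j' \<le> ?k") simp_all
    qed
    define X where "X = boxes mu B d \<inter> boxes mu ?A (Suc d)"
    have Xs: "X \<subseteq> boxes mu ?A (Suc d)" by (simp add: X_def)
    have "X `` {Suc d} = boxes mu B d `` {Suc d}" by (auto simp: X_def boxes_def row_tab_def)
    moreover have "boxes mu ?A d `` {Suc d} = {}" by (auto simp: boxes_row_tab)
    ultimately have "card X = ?k"
      using rowX[OF Xs, of "Suc d"] rows[of d "Suc d"] unfolding R
      by (simp add: card_row_boxes_replace[OF mu Zs] rowX[OF Zs] Zc)
    moreover have "B = replace_at X d ?A"
    proof
      fix p :: "nat \<times> nat"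
      obtain i j where p: "p = (i, j)" by (meson surj_pair)
      show "B p = replace_at X d ?A p"
      proof (cases "p \<in> diagram mu")
        case True
        then show ?thesis using vals[of i j]
          by (auto simp: p replace_at_def X_def boxes_def row_tab_def)
      next
        case False
        then show ?thesis using PiE_arb[OF tableaux_PiE[OF Bt] False]
          by (simp add: replace_at_def X_def boxes_def row_tab_def)
      qed
    qed
    ultimately show ?thesis using Xs by (auto simp: box_choices_def)
  qed
  have inj: "inj_on (\<lambda>X. replace_at X d ?A) (box_choices mu ?A d ?k)"
  proof (rule inj_onI)
    fix X Y assume X: "X \<in> box_choices mu ?A d ?k" and Y: "Y \<in> box_choices mu ?A d ?k"
      and eq: "replace_at X d ?A = replace_at Y d ?A"
    \<comment> \<open>The replaced boxes can be read off from the result.\<close>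
    have rec: "Z = {p \<in> boxes mu ?A (Suc d). replace_at Z d ?A p = d}" if "Z \<in> box_choices mu ?A d ?k" for Z
      using that by (auto simp: box_choices_def replace_at_def boxes_def)
    show "X = Y" using rec[OF X] rec[OF Y] eq by simp
  qed
  show ?thesis unfolding bij_betw_def using inj into surj by blast
qed

context hecke_algebra
begin

lemma merge_word_tableau:
  assumes lam: "composition n lam"
  shows "merge_word r d k (word lam A) = (\<Sum>X\<in>box_choices lam A d k.
    scale (q ^ later_boxes lam A d X) (word_sum r (word lam (replace_at X d A))))"
proof -
  have Xd: "X \<subseteq> diagram lam" if "X \<in> box_choices lam A d k" for X
    using that by (auto simp: box_choices_def boxes_def)
  have inj: "inj_on ((`) (init_tab lam)) (box_choices lam A d k)"
  proof (rule inj_onI)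
    fix X Y assume "X \<in> box_choices lam A d k" "Y \<in> box_choices lam A d k"
      "init_tab lam ` X = init_tab lam ` Y"
    then show "X = Y"
      using Xd inj_on_image_eq_iff[of "init_tab lam" "diagram lam" X Y] init_tab_bij[OF lam]
      by (simp add: bij_betw_def)
  qed
  have ws: "word_sum r (replace_at (init_tab lam ` X) d (word lam A)) = word_sum r (word lam (replace_at X d A))"
    if "X \<subseteq> diagram lam" for X
    by (rule word_sum_cong) (rule replace_at_word[OF lam that])
  show ?thesis
    unfolding merge_word_def choices_word[OF lam] sum.reindex[OF inj]
    by (rule sum.cong) (simp_all add: card_later_pairs_word[OF lam Xd] ws[OF Xd])
qed

lemma word_row_tab:
  "composition n mu \<Longrightarrow> x \<in> {1..n} \<Longrightarrow> word mu (row_tab mu) x = row_index mu x"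
  by (simp add: word_def row_tab_def row_index_def box_in)

text \<open>
  In the word of \<open>row_tab\<close> every letter \<open>d\<close> precedes every letter \<open>d + 1\<close>, so all powers of \<open>q\<close> in
  \<open>merge_word\<close> are trivial.
\<close>

lemma row_class_sum_psi_tab:
  assumes mu: "composition n mu" and d: "1 \<le> d" and t: "t \<le> mu (d + 1)"
  shows "row_class_sum mu (nu_comp mu d t) (psi_tab mu d t) =
    merge_word (row_index (nu_comp mu d t)) d (mu (d + 1) - t) (row_index mu)"
proof -
  let ?r = "row_index (nu_comp mu d t)" and ?A = "row_tab mu" and ?k = "mu (d + 1) - t"
  have later: "later_boxes mu ?A d X = 0" if X: "X \<in> box_choices mu ?A d ?k" for X
  proof -
    have "\<not> init_tab mu x < init_tab mu p" if x: "x \<in> X" and p: "p \<in> boxes mu ?A d" for x p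
    proof -
      obtain j where j: "x = (Suc d, j)" "(Suc d, j) \<in> diagram mu"
        using x X by (auto simp: box_choices_def boxes_row_tab)
      obtain j' where j': "p = (d, j')" "(d, j') \<in> diagram mu" using p by (auto simp: boxes_row_tab)
      show ?thesis unfolding j(1) j'(1) init_tab_less_iff[OF j(2) j'(2)] by simp
    qed
    then have e: "{(x, p). x \<in> X \<and> p \<in> boxes mu ?A d \<and> init_tab mu x < init_tab mu p} = {}" by blast
    show ?thesis unfolding later_boxes_def e by simp
  qed
  have "merge_word ?r d ?k (row_index mu) = merge_word ?r d ?k (word mu ?A)"
    by (rule merge_word_cong) (rule word_row_tab[OF mu, symmetric])
  also have "\<dots> = (\<Sum>X\<in>box_choices mu ?A d ?k. word_sum ?r (word mu (replace_at X d ?A)))"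
    unfolding merge_word_tableau[OF mu] by (rule sum.cong) (simp_all add: later)
  also have "\<dots> = row_class_sum mu (nu_comp mu d t) (psi_tab mu d t)"
    unfolding row_class_sum_def by (rule sum.reindex_bij_betw[OF row_class_psi_tab[OF assms]])
  finally show ?thesis ..
qed

lemma psi_tab_tableaux:
  assumes mu: "composition n mu" and d: "1 \<le> d" and t: "t \<le> mu (d + 1)"
  shows "psi_tab mu d t \<in> tableaux mu (nu_comp mu d t)"
proof -
  let ?Z = "Pair (Suc d) ` {1..mu (d + 1) - t}"
  have Zs: "?Z \<subseteq> boxes mu (row_tab mu) (Suc d)" by (auto simp: boxes_row_tab diagram_def)
  have Zc: "card ?Z = mu (d + 1) - t" by (simp add: card_image inj_on_def)
  have "psi_tab mu d t = replace_at ?Z d (row_tab mu)"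
    by (auto simp: psi_tab_def replace_at_def row_tab_def fun_eq_iff diagram_def)
  then show ?thesis using tableaux_replace_down[OF mu row_tab_tableaux[OF mu] d t Zs Zc] by simp
qed

text \<open>
  Since \<open>\<psi>\<close> commutes with right multiplication, its value on \<open>x\<^sub>\<mu> T (1\<^sub>B)\<close> is \<open>\<psi> (x\<^sub>\<mu>) T (1\<^sub>B)\<close>, and
  \<open>merge_word\<close> is carried from the word of \<open>x\<^sub>\<mu>\<close> to that of \<open>B\<close> along the ascents of \<open>1\<^sub>B\<close>.
\<close>

lemma psi_Theta_eval:
  assumes "q \<noteq> 0" "n \<ge> 2" and lam: "composition n lam" and mu: "composition n mu"
    and d: "1 \<le> d" and t: "t \<le> mu (d + 1)" and A: "A \<in> tableaux lam mu"
  shows "psi n T mu d t (Theta n T lam mu A (x_elt n T lam * h)) =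
    (\<Sum>B\<in>row_class lam mu A.
      merge_word (row_index (nu_comp mu d t)) d (mu (d + 1) - t) (word lam B)) * h"
proof -
  let ?nu = "nu_comp mu d t" and ?w = "tab_perm n lam mu"
  note nu = composition_nu_comp[OF mu d t]
  have tab: "B \<in> tableaux lam mu" if "B \<in> row_class lam mu A" for B using that by (simp add: row_class_def)
  have "row_class_sum lam mu A = x_elt n T mu * (\<Sum>B\<in>row_class lam mu A. T (?w B))"
    unfolding row_class_sum_def sum_distrib_left
    by (rule sum.cong) (simp_all add: x_elt_times_tab_perm[OF assms(1-4) tab])
  then have "psi n T mu d t (Theta n T lam mu A (x_elt n T lam * h)) =
    psi n T mu d t (x_elt n T mu * ((\<Sum>B\<in>row_class lam mu A. T (?w B)) * h))"
    unfolding Theta_eval[OF assms(1-4) A] by (simp only: mult.assoc)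
  also have "\<dots> = row_class_sum mu ?nu (psi_tab mu d t) * ((\<Sum>B\<in>row_class lam mu A. T (?w B)) * h)"
    unfolding psi_def by (rule Theta_eval[OF assms(1,2) mu nu psi_tab_tableaux[OF mu d t]])
  also have "\<dots> = (\<Sum>B\<in>row_class lam mu A.
      merge_word (row_index ?nu) d (mu (d + 1) - t) (row_index mu) * T (?w B)) * h"
    unfolding row_class_sum_psi_tab[OF mu d t] by (simp only: sum_distrib_left mult.assoc[symmetric])
  also have "(\<Sum>B\<in>row_class lam mu A.
      merge_word (row_index ?nu) d (mu (d + 1) - t) (row_index mu) * T (?w B)) =
    (\<Sum>B\<in>row_class lam mu A. merge_word (row_index ?nu) d (mu (d + 1) - t) (word lam B))"
  proof (rule sum.cong[OF refl])
    fix B assume "B \<in> row_class lam mu A"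
    note s = tab_perm_spec[OF lam mu tab[OF this]]
    have wS: "?w B \<in> Sym n" using s(1) by (simp add: perms_of_word_def)
    have "merge_word (row_index ?nu) d (mu (d + 1) - t) (row_index mu) * T (?w B) =
      merge_word (row_index ?nu) d (mu (d + 1) - t) (row_index mu \<circ> inv (?w B))"
      by (rule merge_word_times_T[OF assms(1,2) mono_row_index[OF mu] mono_row_index[OF nu] wS s(2)])
    also have "\<dots> = merge_word (row_index ?nu) d (mu (d + 1) - t) (word lam B)"
      by (rule merge_word_cong) (simp add: perms_of_word_inv[OF s(1)])
    finally show "merge_word (row_index ?nu) d (mu (d + 1) - t) (row_index mu) * T (?w B) =
      merge_word (row_index ?nu) d (mu (d + 1) - t) (word lam B)" .
  qed
  finally show ?thesis .
qed

end

section \<open>Collecting equal tableaux\<close>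

lemma exists_initial_subset:
  fixes J :: "nat set"
  assumes "finite J" "b \<le> card J"
  shows "\<exists>Y\<subseteq>J. card Y = b \<and> (\<forall>y\<in>Y. \<forall>x\<in>J. x < y \<longrightarrow> x \<in> Y)"
  using assms(2)
proof (induction b)
  case 0
  then show ?case by (intro exI[of _ "{}"]) simp
next
  case (Suc b)
  then obtain Y where Y: "Y \<subseteq> J" "card Y = b" "\<forall>y\<in>Y. \<forall>x\<in>J. x < y \<longrightarrow> x \<in> Y" by auto
  have fin: "finite Y" "finite (J - Y)" using Y(1) assms(1) finite_subset by auto
  have "J - Y \<noteq> {}"
  proof
    assume "J - Y = {}"
    then have "Y = J" using Y(1) by blast
    then show False using Y(2) Suc.prems by simp
  qed
  define m where "m = Min (J - Y)"
  have m: "m \<in> J" "m \<notin> Y" using Min_in[OF fin(2) \<open>J - Y \<noteq> {}\<close>] by (auto simp: m_def)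
  have least: "x \<in> Y" if "x \<in> J" "x < m" for x
  proof (rule ccontr)
    assume "x \<notin> Y"
    then have "m \<le> x" unfolding m_def using that fin(2) by (intro Min_le) auto
    then show False using that(2) by simp
  qed
  have "card (insert m Y) = Suc b" using fin m Y(2) by simp
  moreover have "\<forall>y\<in>insert m Y. \<forall>x\<in>J. x < y \<longrightarrow> x \<in> insert m Y" using least Y(3) by blast
  moreover have "insert m Y \<subseteq> J" using m Y(1) by blast
  ultimately show ?case by blast
qed

lemma row_standard_unique:
  assumes S: "S \<in> diagram lam \<rightarrow>\<^sub>E U" "row_standard lam S"
    and S': "S' \<in> diagram lam \<rightarrow>\<^sub>E U'" "row_standard lam S'"
    and eq: "row_equiv lam S S'"
  shows "S = S'"
proof
  fix p :: "nat \<times> nat"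
  obtain i j where p: "p = (i, j)" by (meson surj_pair)
  show "S p = S' p"
  proof (cases "p \<in> diagram lam")
    case True
    let ?xs = "[1..<Suc (lam i)]"
    have i: "1 \<le> i" and j: "1 \<le> j" "j \<le> lam i" using True by (auto simp: p diagram_def)
    have row: "{j. (i, j) \<in> diagram lam} = {1..<Suc (lam i)}" using i by (auto simp: diagram_def)
    have ms: "mset (map (\<lambda>j. R (i, j)) ?xs) = row_mset lam R i" for R
      unfolding row_mset_def row by (simp del: upt_Suc)
    have sorted: "sorted (map (\<lambda>j. R (i, j)) ?xs)" if "row_standard lam R" for R
      unfolding sorted_iff_nth_mono
    proof (intro allI impI)
      fix a b assume ab: "a \<le> b" "b < length (map (\<lambda>j. R (i, j)) ?xs)"
      then have "(i, Suc a) \<in> diagram lam" "(i, Suc b) \<in> diagram lam" using i by (auto simp: diagram_def simp del: upt_Suc)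
      then have "R (i, Suc a) \<le> R (i, Suc b)" using that ab(1) unfolding row_standard_def by simp
      then show "map (\<lambda>j. R (i, j)) ?xs ! a \<le> map (\<lambda>j. R (i, j)) ?xs ! b"
        using ab by (simp del: upt_Suc)
    qed
    have "mset (map (\<lambda>j. S (i, j)) ?xs) = mset (map (\<lambda>j. S' (i, j)) ?xs)"
      unfolding ms using eq i by (simp add: row_equiv_def)
    then have "map (\<lambda>j. S (i, j)) ?xs = map (\<lambda>j. S' (i, j)) ?xs"
      using properties_for_sort sorted[OF S(2)] sorted[OF S'(2)] by metis
    then show ?thesis using j by (simp add: p del: upt_Suc)
  next
    case False
    then show ?thesis by (simp add: PiE_arb[OF S(1)] PiE_arb[OF S'(1)])
  qed
qed

lemma card_rows:
  assumes lam: "composition n lam" and X: "X \<subseteq> diagram lam"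
  shows "card X = (\<Sum>i | lam i \<noteq> 0. card (X `` {i}))"
proof -
  have "X = Sigma {i. lam i \<noteq> 0} (\<lambda>i. X `` {i})"
    using X unfolding diagram_Sigma[OF lam] by auto
  moreover have "finite (X `` {i})" for i
    using X by (intro finite_subset[OF _ finite_row[OF lam, of i]]) auto
  then have "card (Sigma {i. lam i \<noteq> 0} (\<lambda>i. X `` {i})) = (\<Sum>i | lam i \<noteq> 0. card (X `` {i}))"
    using lam by (intro card_SigmaI) (auto simp: composition_def)
  ultimately show ?thesis by simp
qed

lemma finite_row_boxes: "composition n lam \<Longrightarrow> finite (boxes lam A k `` {i})"
  using finite_row by (simp add: boxes_row)

lemma num_replaced_eq:
  assumes "X \<subseteq> boxes lam A (Suc d)"
  shows "num_replaced lam A (replace_at X d A) i = card (X `` {i})"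
proof -
  have "{j. (i, j) \<in> diagram lam \<and> replace_at X d A (i, j) \<noteq> A (i, j)} = X `` {i}"
    using assms by (auto simp: replace_at_def boxes_def)
  then show ?thesis by (simp add: num_replaced_def)
qed

lemma replaced_tableaux_iff:
  "S \<in> replaced_tableaux lam mu d t A \<longleftrightarrow> S \<in> tableaux lam (nu_comp mu d t) \<and> row_standard lam S \<and>
    (\<exists>X\<in>box_choices lam A d (mu (d + 1) - t). S = replace_at X d A)"
  unfolding replaced_tableaux_def box_choices_def boxes_def replace_at_def by auto

lemma replaced_row_counts:
  assumes lam: "composition n lam" and S: "S \<in> replaced_tableaux lam mu d t A"
  shows "num_replaced lam A S i \<le> card (boxes lam A (Suc d) `` {i})"
    and "card (boxes lam S k `` {i}) =
      (if k = d then card (boxes lam A d `` {i}) + num_replaced lam A S i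
       else if k = Suc d then card (boxes lam A (Suc d) `` {i}) - num_replaced lam A S i
       else card (boxes lam A k `` {i}))"
    and "(\<Sum>i | lam i \<noteq> 0. num_replaced lam A S i) = mu (d + 1) - t"
proof -
  obtain X where X: "X \<subseteq> boxes lam A (Suc d)" "card X = mu (d + 1) - t" and Seq: "S = replace_at X d A"
    using S unfolding replaced_tableaux_iff box_choices_def by auto
  have nr: "num_replaced lam A S i = card (X `` {i})" for i unfolding Seq by (rule num_replaced_eq[OF X(1)])
  show "num_replaced lam A S i \<le> card (boxes lam A (Suc d) `` {i})"
    unfolding nr using X(1) by (intro card_mono finite_row_boxes[OF lam]) blast
  show "card (boxes lam S k `` {i}) =
      (if k = d then card (boxes lam A d `` {i}) + num_replaced lam A S i
       else if k = Suc d then card (boxes lam A (Suc d) `` {i}) - num_replaced lam A S i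
       else card (boxes lam A k `` {i}))"
    unfolding nr unfolding Seq by (subst card_row_boxes_replace[OF lam X(1)]) auto
  have "X \<subseteq> diagram lam" using X by (auto simp: boxes_def)
  then show "(\<Sum>i | lam i \<noteq> 0. num_replaced lam A S i) = mu (d + 1) - t"
    unfolding nr using card_rows[OF lam] X(2) by simp
qed

text \<open>
  The candidates for the set of replaced boxes, seen from the tableau after the replacement.
\<close>

definition row_choices :: "(nat \<Rightarrow> nat) \<Rightarrow> (nat \<times> nat \<Rightarrow> nat) \<Rightarrow> nat \<Rightarrow> (nat \<Rightarrow> nat) \<Rightarrow> (nat \<times> nat) set set" where
  "row_choices lam S d \<beta> = {X. X \<subseteq> boxes lam S d \<and> (\<forall>i. card (X `` {i}) = \<beta> i)}"

lemma row_choices_into: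
  assumes lam: "composition n lam" and A: "A \<in> tableaux lam mu" and d: "1 \<le> d" and t: "t \<le> mu (d + 1)"
    and S: "S \<in> replaced_tableaux lam mu d t A" and R: "R \<in> row_class lam (nu_comp mu d t) S"
    and X: "X \<in> row_choices lam R d (num_replaced lam A S)"
  shows "replace_at X (Suc d) R \<in> row_class lam mu A"
    and "X \<in> box_choices lam (replace_at X (Suc d) R) d (mu (d + 1) - t)"
proof -
  have Xs: "X \<subseteq> boxes lam R d" and Xr: "card (X `` {i}) = num_replaced lam A S i" for i
    using X by (auto simp: row_choices_def)
  have Xd: "X \<subseteq> diagram lam" using Xs by (auto simp: boxes_def)
  have Xc: "card X = mu (d + 1) - t"
    unfolding card_rows[OF lam Xd] Xr by (rule replaced_row_counts(3)[OF lam S])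
  have Rt: "R \<in> tableaux lam (nu_comp mu d t)"
    and Rr: "card (boxes lam R k `` {i}) = card (boxes lam S k `` {i})" for k i
    using R row_equiv_iff[OF lam] by (auto simp: row_class_def)
  have "replace_at X (Suc d) R \<in> tableaux lam mu"
    by (rule tableaux_replace_up[OF lam Rt d t Xs Xc])
  moreover have "row_equiv lam (replace_at X (Suc d) R) A"
    unfolding row_equiv_iff[OF lam]
  proof (intro allI)
    fix i k
    show "card (boxes lam (replace_at X (Suc d) R) k `` {i}) = card (boxes lam A k `` {i})"
      using replaced_row_counts(1)[OF lam S, of i]
      by (subst card_row_boxes_replace[OF lam Xs]) (simp_all add: Rr Xr replaced_row_counts(2)[OF lam S])
  qed
  ultimately show "replace_at X (Suc d) R \<in> row_class lam mu A" by (simp add: row_class_def)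
  have "X \<subseteq> boxes lam (replace_at X (Suc d) R) (Suc d)"
    using Xd by (auto simp: boxes_def replace_at_def)
  then show "X \<in> box_choices lam (replace_at X (Suc d) R) d (mu (d + 1) - t)"
    using Xc by (simp add: box_choices_def)
qed

text \<open>
  The row standard representative of \<open>replace_at X d B\<close> is obtained from \<open>A\<close> by replacing the leftmost
  entries \<open>d + 1\<close> of each row, as many as \<open>X\<close> replaces there.
\<close>

lemma exists_replaced_tableau:
  assumes lam: "composition n lam" and A: "A \<in> tableaux lam mu" "row_standard lam A"
    and d: "1 \<le> d" and t: "t \<le> mu (d + 1)"
    and B: "B \<in> row_class lam mu A" and X: "X \<in> box_choices lam B d (mu (d + 1) - t)"
  shows "\<exists>S\<in>replaced_tableaux lam mu d t A. replace_at X d B \<in> row_class lam (nu_comp mu d t) S \<and>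
    X \<in> row_choices lam (replace_at X d B) d (num_replaced lam A S)"
proof -
  have Bt: "B \<in> tableaux lam mu" and Br: "card (boxes lam B k `` {i}) = card (boxes lam A k `` {i})" for k i
    using B row_equiv_iff[OF lam] by (auto simp: row_class_def)
  have Xs: "X \<subseteq> boxes lam B (Suc d)" and Xc: "card X = mu (d + 1) - t"
    using X by (auto simp: box_choices_def)
  have Xd: "X \<subseteq> diagram lam" using Xs by (auto simp: boxes_def)
  have "\<exists>Y\<subseteq>boxes lam A (Suc d) `` {i}. card Y = card (X `` {i}) \<and>
      (\<forall>y\<in>Y. \<forall>x\<in>boxes lam A (Suc d) `` {i}. x < y \<longrightarrow> x \<in> Y)" for i
  proof (rule exists_initial_subset)
    have "X `` {i} \<subseteq> boxes lam B (Suc d) `` {i}" using Xs by blast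
    then have "card (X `` {i}) \<le> card (boxes lam B (Suc d) `` {i})"
      by (intro card_mono finite_row_boxes[OF lam])
    then show "card (X `` {i}) \<le> card (boxes lam A (Suc d) `` {i})" by (simp only: Br)
  qed (rule finite_row_boxes[OF lam])
  then obtain Y where Y: "Y i \<subseteq> boxes lam A (Suc d) `` {i}" "card (Y i) = card (X `` {i})"
      "\<forall>y\<in>Y i. \<forall>x\<in>boxes lam A (Suc d) `` {i}. x < y \<longrightarrow> x \<in> Y i" for i
    by metis
  define Z where "Z = {(i, j). j \<in> Y i}"
  have Zs: "Z \<subseteq> boxes lam A (Suc d)" using Y(1) by (auto simp: Z_def)
  have Zd: "Z \<subseteq> diagram lam" using Zs by (auto simp: boxes_def)
  have Zr: "card (Z `` {i}) = card (X `` {i})" for i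
  proof -
    have "Z `` {i} = Y i" by (auto simp: Z_def)
    then show ?thesis by (simp add: Y(2))
  qed
  have Zc: "card Z = mu (d + 1) - t"
    using card_rows[OF lam Zd] card_rows[OF lam Xd] Xc by (simp add: Zr)
  define S where "S = replace_at Z d A"
  have St: "S \<in> tableaux lam (nu_comp mu d t)"
    unfolding S_def by (rule tableaux_replace_down[OF lam A(1) d t Zs Zc])
  have "row_standard lam S"
    unfolding row_standard_def
  proof (intro allI impI, elim conjE)
    fix i j k assume jk: "(i, j) \<in> diagram lam" "(i, k) \<in> diagram lam" "j \<le> k"
    have le: "A (i, j) \<le> A (i, k)" using A(2) jk unfolding row_standard_def by blast
    have AZ: "A p = Suc d" if "p \<in> Z" for p using that Zs by (auto simp: boxes_def)
    \<comment> \<open>Only a replaced box \<open>(i, k)\<close> is critical; an entry \<open>d + 1\<close> to its left has been replaced too.\<close>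
    show "S (i, j) \<le> S (i, k)"
    proof (cases "(i, k) \<in> Z")
      case False
      then have "S (i, k) = A (i, k)" by (simp add: S_def replace_at_def)
      moreover have "S (i, j) \<le> A (i, j)" using AZ[of "(i, j)"] by (simp add: S_def replace_at_def)
      ultimately show ?thesis using le by simp
    next
      case True
      have "A (i, j) \<le> d \<or> (i, j) \<in> Z"
      proof (cases "A (i, j) = Suc d")
        case eq: True
        then have "j \<in> boxes lam A (Suc d) `` {i}" using jk by (simp add: boxes_row)
        then show ?thesis using Y(3)[of i] True jk(3) unfolding Z_def by (cases "j = k") auto
      next
        case False
        then show ?thesis using le AZ[OF True] by simp
      qed
      then show ?thesis using True by (auto simp: S_def replace_at_def)
    qed
  qed
  then have S: "S \<in> replaced_tableaux lam mu d t A"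
    unfolding replaced_tableaux_iff using St Zs Zc S_def by (auto simp: box_choices_def)
  have nr: "num_replaced lam A S i = card (X `` {i})" for i
    unfolding S_def num_replaced_eq[OF Zs] by (rule Zr)
  have "replace_at X d B \<in> tableaux lam (nu_comp mu d t)"
    by (rule tableaux_replace_down[OF lam Bt d t Xs Xc])
  moreover have "row_equiv lam (replace_at X d B) S"
    unfolding row_equiv_iff[OF lam] S_def
    by (simp add: card_row_boxes_replace[OF lam Xs] card_row_boxes_replace[OF lam Zs] Br Zr)
  moreover have "X \<subseteq> boxes lam (replace_at X d B) d" using Xd by (auto simp: boxes_def replace_at_def)
  ultimately show ?thesis using S nr by (intro bexI[of _ S]) (simp_all add: row_class_def row_choices_def)
qed

text \<open>
  Undoing the replacement: \<open>R\<close> and \<open>X\<close> determine \<open>B\<close>, and \<open>S\<close> is the only row standard tableau row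
  equivalent to \<open>R\<close>.
\<close>

lemma replacement_bij:
  assumes lam: "composition n lam" and A: "A \<in> tableaux lam mu" "row_standard lam A"
    and d: "1 \<le> d" and t: "t \<le> mu (d + 1)"
  shows "bij_betw (\<lambda>(S, R, X). (replace_at X (Suc d) R, X))
    (SIGMA S:replaced_tableaux lam mu d t A. SIGMA R:row_class lam (nu_comp mu d t) S.
      row_choices lam R d (num_replaced lam A S))
    (SIGMA B:row_class lam mu A. box_choices lam B d (mu (d + 1) - t))" (is "bij_betw ?f ?Q ?P")
proof -
  have "inj_on ?f ?Q"
  proof (rule inj_onI)
    fix a b assume a: "a \<in> ?Q" and b: "b \<in> ?Q" and eq: "?f a = ?f b"
    obtain S R X where aa: "a = (S, R, X)" by (metis prod_cases3)
    obtain S' R' X' where bb: "b = (S', R', X')" by (metis prod_cases3)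
    have X: "X' = X" and up: "replace_at X (Suc d) R = replace_at X (Suc d) R'" using eq by (auto simp: aa bb)
    have sub: "X \<subseteq> boxes lam R d" "X \<subseteq> boxes lam R' d"
      using a b by (auto simp: aa bb X row_choices_def)
    have R: "R = R'"
      using arg_cong[OF up, of "replace_at X d"]
      unfolding replace_at_back[OF sub(1)] replace_at_back[OF sub(2)] .
    have S: "S \<in> replaced_tableaux lam mu d t A" "S' \<in> replaced_tableaux lam mu d t A"
      and e: "row_equiv lam R S" "row_equiv lam R S'"
      using a b by (auto simp: aa bb R row_class_def)
    have "row_equiv lam S S'" using e by (simp add: row_equiv_def)
    moreover have "S \<in> diagram lam \<rightarrow>\<^sub>E {1..}" "row_standard lam S"
      "S' \<in> diagram lam \<rightarrow>\<^sub>E {1..}" "row_standard lam S'"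
      using S tableaux_PiE unfolding replaced_tableaux_iff by auto
    ultimately have "S = S'" by (intro row_standard_unique)
    then show "a = b" by (simp add: aa bb R X)
  qed
  moreover have "?f ` ?Q = ?P"
  proof (intro subset_antisym subsetI)
    fix z assume "z \<in> ?f ` ?Q"
    then obtain S R X where "S \<in> replaced_tableaux lam mu d t A" "R \<in> row_class lam (nu_comp mu d t) S"
      "X \<in> row_choices lam R d (num_replaced lam A S)" "z = (replace_at X (Suc d) R, X)" by auto
    then show "z \<in> ?P" using row_choices_into[OF lam A(1) d t] by simp
  next
    fix z assume "z \<in> ?P"
    then obtain B X where z: "z = (B, X)" and B: "B \<in> row_class lam mu A"
      and X: "X \<in> box_choices lam B d (mu (d + 1) - t)" by auto
    obtain S where S: "S \<in> replaced_tableaux lam mu d t A"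
      "replace_at X d B \<in> row_class lam (nu_comp mu d t) S"
      "X \<in> row_choices lam (replace_at X d B) d (num_replaced lam A S)"
      using exists_replaced_tableau[OF lam A d t B X] by blast
    have "X \<subseteq> boxes lam B (Suc d)" using X by (simp add: box_choices_def)
    then have "z = ?f (S, replace_at X d B, X)" by (simp add: z replace_at_back)
    moreover have "(S, replace_at X d B, X) \<in> ?Q" using S by simp
    ultimately show "z \<in> ?f ` ?Q" by (rule image_eqI)
  qed
  ultimately show ?thesis by (simp add: bij_betw_def)
qed

section \<open>The coefficients\<close>

text \<open>
  A later box in reading order lies in the same row further right, or in a lower row. The boxes of
  the second kind are counted in \<open>A\<close> instead of \<open>B\<close>, as row equivalent tableaux have equally many
  entries \<open>d\<close> below row \<open>i\<close>.
\<close>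

lemma later_boxes_rows:
  assumes lam: "composition n lam" and X: "X \<subseteq> boxes lam R d"
    and B: "replace_at X (Suc d) R \<in> row_class lam mu A"
  shows "later_boxes lam (replace_at X (Suc d) R) d X =
    (\<Sum>i | 1 \<le> i \<and> lam i \<noteq> 0.
      card {(x, p). x \<in> X `` {i} \<and> p \<in> boxes lam R d `` {i} - X `` {i} \<and> x < p} +
      card {(k, j) \<in> diagram lam. k > i \<and> A (k, j) = d} * card (X `` {i}))"
proof -
  let ?I = "{i. 1 \<le> i \<and> lam i \<noteq> 0}" and ?init = "init_tab lam"
  define E where "E = boxes lam R d - X"
  have bE: "boxes lam (replace_at X (Suc d) R) d = E"
    unfolding E_def by (rule boxes_replace(2)[OF X]) simp
  have Xd: "X \<subseteq> diagram lam" and Ed: "E \<subseteq> diagram lam" using X by (auto simp: E_def boxes_def)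
  have finX: "finite X" and finE: "finite E"
    using finite_subset[OF Xd finite_diagram[OF lam]] finite_subset[OF Ed finite_diagram[OF lam]] by auto
  have finI: "finite ?I" using lam by (simp add: composition_def)
  have finXi: "finite (X `` {i})" for i
    using Xd by (intro finite_subset[OF _ finite_row[OF lam, of i]]) auto
  have below: "card {p \<in> E. i < fst p} = card {(k, j) \<in> diagram lam. k > i \<and> A (k, j) = d}" for i
  proof -
    have rows: "card (E `` {i'}) = card (boxes lam A d `` {i'})" for i'
      using B unfolding row_class_def row_equiv_iff[OF lam] bE[symmetric] by blast
    have im: "{p \<in> Z. i < fst p} `` {i'} = (if i < i' then Z `` {i'} else {})" for Z :: "(nat \<times> nat) set" and i'
      by auto
    have eq: "card ({p \<in> E. i < fst p} `` {i'}) = card ({p \<in> boxes lam A d. i < fst p} `` {i'})" for i'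
      unfolding im using rows by simp
    have sub: "{p \<in> E. i < fst p} \<subseteq> diagram lam" "{p \<in> boxes lam A d. i < fst p} \<subseteq> diagram lam"
      using Ed by (auto simp: boxes_def)
    have "card {p \<in> E. i < fst p} = card {p \<in> boxes lam A d. i < fst p}"
      unfolding card_rows[OF lam sub(1)] card_rows[OF lam sub(2)] eq ..
    also have "{p \<in> boxes lam A d. i < fst p} = {(k, j) \<in> diagram lam. k > i \<and> A (k, j) = d}"
      by (auto simp: boxes_def)
    finally show ?thesis .
  qed
  have later: "card {p \<in> E. ?init (i, j) < ?init p} =
      card {p \<in> E `` {i}. j < p} + card {p \<in> E. i < fst p}" if ij: "(i, j) \<in> X" for i j
  proof -
    have lt: "?init (i, j) < ?init (i', j') \<longleftrightarrow> i < i' \<or> i = i' \<and> j < j'" if "(i', j') \<in> E" for i' j'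
      by (rule init_tab_less_iff) (use ij that Xd Ed in auto)
    have "{p \<in> E. ?init (i, j) < ?init p} = Pair i ` {p \<in> E `` {i}. j < p} \<union> {p \<in> E. i < fst p}"
      using lt by (auto simp: image_iff)
    moreover have "Pair i ` {p \<in> E `` {i}. j < p} \<inter> {p \<in> E. i < fst p} = {}" by auto
    moreover have "finite {p \<in> E `` {i}. j < p}"
      using Ed by (intro finite_subset[OF _ finite_row[OF lam, of i]]) auto
    ultimately show ?thesis
      using finE by (simp add: card_Un_disjoint card_image inj_on_def)
  qed
  have "later_boxes lam (replace_at X (Suc d) R) d X = card (SIGMA x:X. {p \<in> E. ?init x < ?init p})"
    unfolding later_boxes_def bE by (rule arg_cong[of _ _ card]) auto
  also have "\<dots> = (\<Sum>x\<in>X. card {p \<in> E. ?init x < ?init p})"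
    by (rule card_SigmaI) (use finX finE in auto)
  also have "\<dots> = (\<Sum>x\<in>Sigma ?I (\<lambda>i. X `` {i}). card {p \<in> E. ?init x < ?init p})"
    by (rule arg_cong[of _ _ "sum _"]) (use Xd in \<open>auto simp: diagram_def\<close>)
  also have "(\<Sum>x\<in>Sigma ?I (\<lambda>i. X `` {i}). card {p \<in> E. ?init x < ?init p}) =
      (\<Sum>i\<in>?I. \<Sum>j\<in>X `` {i}. card {p \<in> E. ?init (i, j) < ?init p})"
    using sum.Sigma[of ?I "\<lambda>i. X `` {i}" "\<lambda>i j. card {p \<in> E. ?init (i, j) < ?init p}"] finI finXi
    by (simp add: case_prod_unfold)
  also have "\<dots> = (\<Sum>i\<in>?I. (\<Sum>j\<in>X `` {i}. card {p \<in> E `` {i}. j < p}) + card {p \<in> E. i < fst p} * card (X `` {i}))"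
    by (rule sum.cong[OF refl]) (simp add: later sum.distrib)
  also have "\<dots> = (\<Sum>i\<in>?I.
      card {(x, p). x \<in> X `` {i} \<and> p \<in> boxes lam R d `` {i} - X `` {i} \<and> x < p} +
      card {(k, j) \<in> diagram lam. k > i \<and> A (k, j) = d} * card (X `` {i}))"
  proof (rule sum.cong[OF refl])
    fix i
    have Ei: "E `` {i} = boxes lam R d `` {i} - X `` {i}" by (auto simp: E_def)
    have "{(x, p). x \<in> X `` {i} \<and> p \<in> E `` {i} \<and> x < p} = (SIGMA x:X `` {i}. {p \<in> E `` {i}. x < p})"
      by auto
    moreover have "card (SIGMA x:X `` {i}. {p \<in> E `` {i}. x < p}) = (\<Sum>j\<in>X `` {i}. card {p \<in> E `` {i}. j < p})"
    proof (rule card_SigmaI)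
      have "finite (E `` {i})"
        using Ed by (intro finite_subset[OF _ finite_row[OF lam, of i]]) auto
      then have "finite {p \<in> E `` {i}. x < p}" for x by (rule finite_subset[rotated]) blast
      then show "\<forall>x\<in>X `` {i}. finite {p \<in> E `` {i}. x < p}" by blast
    qed (rule finXi)
    ultimately show "(\<Sum>j\<in>X `` {i}. card {p \<in> E `` {i}. j < p}) + card {p \<in> E. i < fst p} * card (X `` {i}) =
      card {(x, p). x \<in> X `` {i} \<and> p \<in> boxes lam R d `` {i} - X `` {i} \<and> x < p} +
      card {(k, j) \<in> diagram lam. k > i \<and> A (k, j) = d} * card (X `` {i})"
      by (simp add: below Ei)
  qed
  finally show ?thesis .
qed

lemma row_choices_bij:
  assumes lam: "composition n lam" and \<beta>: "\<And>i. i \<notin> I \<Longrightarrow> \<beta> i = 0" and I: "I = {i. 1 \<le> i \<and> lam i \<noteq> 0}"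
  shows "bij_betw (\<lambda>X. restrict (\<lambda>i. X `` {i}) I) (row_choices lam R d \<beta>)
    (PiE I (\<lambda>i. {Y. Y \<subseteq> boxes lam R d `` {i} \<and> card Y = \<beta> i}))"
proof (rule bij_betwI[where g = "\<lambda>g. Sigma I g"])
  show "(\<lambda>X. restrict (\<lambda>i. X `` {i}) I) \<in> row_choices lam R d \<beta> \<rightarrow>
      (PiE I (\<lambda>i. {Y. Y \<subseteq> boxes lam R d `` {i} \<and> card Y = \<beta> i}))"
    by (auto simp: row_choices_def)
  have im: "Sigma I g `` {i} = (if i \<in> I then g i else {})" for g :: "nat \<Rightarrow> nat set" and i by auto
  show "Sigma I \<in> (PiE I (\<lambda>i. {Y. Y \<subseteq> boxes lam R d `` {i} \<and> card Y = \<beta> i})) \<rightarrow> row_choices lam R d \<beta>"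
  proof
    fix g assume g: "g \<in> PiE I (\<lambda>i. {Y. Y \<subseteq> boxes lam R d `` {i} \<and> card Y = \<beta> i})"
    have gi: "g i \<subseteq> boxes lam R d `` {i}" "card (g i) = \<beta> i" if "i \<in> I" for i
      using PiE_mem[OF g that] by auto
    have "card (Sigma I g `` {i}) = \<beta> i" for i
      unfolding im using gi(2) \<beta> by simp
    moreover have "Sigma I g \<subseteq> boxes lam R d" using gi(1) by auto
    ultimately show "Sigma I g \<in> row_choices lam R d \<beta>"
      unfolding row_choices_def by blast
  qed
  show "Sigma I (restrict (\<lambda>i. X `` {i}) I) = X" if "X \<in> row_choices lam R d \<beta>" for X
  proof -
    have "X \<subseteq> diagram lam" using that by (auto simp: row_choices_def boxes_def)
    then have "fst p \<in> I" if "p \<in> X" for p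
      using that unfolding I by (auto simp: diagram_def)
    then show ?thesis by fastforce
  qed
  show "restrict (\<lambda>i. Sigma I g `` {i}) I = g"
    if "g \<in> PiE I (\<lambda>i. {Y. Y \<subseteq> boxes lam R d `` {i} \<and> card Y = \<beta> i})" for g
  proof
    fix i
    show "restrict (\<lambda>i. Sigma I g `` {i}) I i = g i"
      using PiE_arb[OF that, of i] unfolding im by (cases "i \<in> I") simp_all
  qed
qed

text \<open>
  Since \<open>X\<close> is an independent choice of a subset in each row and the exponent is a sum over the rows,
  the sum factors, and every row contributes a Gaussian polynomial.
\<close>

lemma sum_row_choices:
  fixes q :: "'f::field"
  assumes lam: "composition n lam" and A: "A \<in> tableaux lam mu" and d: "1 \<le> d" and t: "t \<le> mu (d + 1)"
    and S: "S \<in> replaced_tableaux lam mu d t A" and R: "R \<in> row_class lam (nu_comp mu d t) S"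
  shows "(\<Sum>X\<in>row_choices lam R d (num_replaced lam A S).
      q ^ later_boxes lam (replace_at X (Suc d) R) d X) = b_coeff q lam d A S"
proof -
  define I where "I = {i. 1 \<le> i \<and> lam i \<noteq> 0}"
  define \<beta> where "\<beta> = num_replaced lam A S"
  define D where "D i = boxes lam R d `` {i}" for i
  define x where "x i = card {(k, j) \<in> diagram lam. k > i \<and> A (k, j) = d}" for i
  \<comment> \<open>The contribution of row \<open>i\<close> to the exponent if the boxes in the columns \<open>Y\<close> of it are replaced.\<close>
  define e where "e i Y = card {(x, p). x \<in> Y \<and> p \<in> D i - Y \<and> x < p} + x i * \<beta> i" for i Y
  have finI: "finite I" using lam by (simp add: composition_def I_def)
  have finD: "finite (D i)" for i unfolding D_def by (rule finite_row_boxes[OF lam])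
  have cardD: "card (D i) = card {j. (i, j) \<in> diagram lam \<and> S (i, j) = d}" for i
    using R row_equiv_iff[OF lam] unfolding D_def by (simp add: row_class_def boxes_row)
  have le: "\<beta> i \<le> card (D i)" for i
    unfolding cardD boxes_row[symmetric] replaced_row_counts(2)[OF lam S] \<beta>_def by simp
  have \<beta>0: "\<beta> i = 0" if "i \<notin> I" for i
  proof -
    have "{j. (i, j) \<in> diagram lam} = {}" using that by (auto simp: I_def diagram_def)
    then show ?thesis by (auto simp: \<beta>_def num_replaced_def)
  qed
  have "(\<Sum>X\<in>row_choices lam R d \<beta>. q ^ later_boxes lam (replace_at X (Suc d) R) d X) =
      (\<Sum>X\<in>row_choices lam R d \<beta>. \<Prod>i\<in>I. q ^ e i (restrict (\<lambda>i. X `` {i}) I i))"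
  proof (rule sum.cong[OF refl])
    fix X assume X: "X \<in> row_choices lam R d \<beta>"
    then have Xs: "X \<subseteq> boxes lam R d" and Xr: "card (X `` {i}) = \<beta> i" for i by (auto simp: row_choices_def)
    have "later_boxes lam (replace_at X (Suc d) R) d X = (\<Sum>i\<in>I. e i (X `` {i}))"
      unfolding later_boxes_rows[OF lam Xs row_choices_into(1)[OF lam A d t S R X[unfolded \<beta>_def]]]
      unfolding I_def e_def D_def x_def Xr ..
    then show "q ^ later_boxes lam (replace_at X (Suc d) R) d X =
        (\<Prod>i\<in>I. q ^ e i (restrict (\<lambda>i. X `` {i}) I i))"
      by (simp add: power_sum)
  qed
  also have "\<dots> = (\<Sum>g\<in>PiE I (\<lambda>i. {Y. Y \<subseteq> D i \<and> card Y = \<beta> i}). \<Prod>i\<in>I. q ^ e i (g i))"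
    unfolding D_def
    by (rule sum.reindex_bij_betw[OF row_choices_bij[OF lam \<beta>0 I_def], where g = "\<lambda>g. \<Prod>i\<in>I. q ^ e i (g i)"])
  also have "\<dots> = (\<Prod>i\<in>I. \<Sum>Y | Y \<subseteq> D i \<and> card Y = \<beta> i. q ^ e i Y)"
    by (rule prod_sum_PiE[symmetric]) (use finI finD in auto)
  also have "\<dots> = (\<Prod>i\<in>I. q ^ (x i * \<beta> i) * gauss q (card (D i)) (\<beta> i))"
    unfolding e_def sum_subsets_gauss[OF finD le, symmetric] power_add
    by (simp add: sum_distrib_left mult.commute)
  also have "\<dots> = b_coeff q lam d A S"
    unfolding b_coeff_def I_def cardD x_def \<beta>_def ..
  finally show ?thesis by (simp add: \<beta>_def)
qed

lemma finite_box_choices: "composition n lam \<Longrightarrow> finite (box_choices lam A d k)"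
  by (rule finite_subset[of _ "Pow (boxes lam A (Suc d))"]) (auto simp: box_choices_def finite_boxes)

lemma finite_row_choices: "composition n lam \<Longrightarrow> finite (row_choices lam A d \<beta>)"
  by (rule finite_subset[of _ "Pow (boxes lam A d)"]) (auto simp: row_choices_def finite_boxes)

lemma finite_replaced_tableaux:
  assumes "composition n lam" "composition n (nu_comp mu d t)"
  shows "finite (replaced_tableaux lam mu d t A)"
  by (rule finite_subset[OF _ finite_tableaux[OF assms]]) (auto simp: replaced_tableaux_def)

context hecke_algebra
begin

lemma sum_replacements:
  assumes lam: "composition n lam" and mu: "composition n mu"
    and A: "A \<in> tableaux lam mu" "row_standard lam A" and d: "1 \<le> d" and t: "t \<le> mu (d + 1)"
  shows "(\<Sum>B\<in>row_class lam mu A. \<Sum>X\<in>box_choices lam B d (mu (d + 1) - t).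
      scale (q ^ later_boxes lam B d X) (f (replace_at X d B))) =
    (\<Sum>S\<in>replaced_tableaux lam mu d t A.
      scale (b_coeff q lam d A S) (\<Sum>R\<in>row_class lam (nu_comp mu d t) S. f R))"
proof -
  let ?k = "mu (d + 1) - t" and ?nu = "nu_comp mu d t"
  note nu = composition_nu_comp[OF mu d t]
  define F where "F = (\<lambda>(B, X). scale (q ^ later_boxes lam B d X) (f (replace_at X d B)))"
  let ?RC = "\<lambda>S R. row_choices lam R d (num_replaced lam A S)"
  let ?Q = "SIGMA S:replaced_tableaux lam mu d t A. SIGMA R:row_class lam ?nu S. ?RC S R"
  have "(\<Sum>B\<in>row_class lam mu A. \<Sum>X\<in>box_choices lam B d ?k.
      scale (q ^ later_boxes lam B d X) (f (replace_at X d B))) =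
    (\<Sum>z\<in>(SIGMA B:row_class lam mu A. box_choices lam B d ?k). F z)"
    unfolding F_def using finite_row_class[OF lam mu] finite_box_choices[OF lam]
    by (intro sum.Sigma) auto
  also have "\<dots> = (\<Sum>z\<in>?Q. F ((\<lambda>(S, R, X). (replace_at X (Suc d) R, X)) z))"
    by (rule sum.reindex_bij_betw[OF replacement_bij[OF lam A d t], symmetric])
  also have "\<dots> = (\<Sum>(S, R, X)\<in>?Q. scale (q ^ later_boxes lam (replace_at X (Suc d) R) d X) (f R))"
  proof (rule sum.cong[OF refl])
    fix z assume z: "z \<in> ?Q"
    obtain S R X where SRX: "z = (S, R, X)" by (metis prod_cases3)
    then have "X \<subseteq> boxes lam R d" using z by (auto simp: row_choices_def)
    then show "F ((\<lambda>(S, R, X). (replace_at X (Suc d) R, X)) z) =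
        (case z of (S, R, X) \<Rightarrow> scale (q ^ later_boxes lam (replace_at X (Suc d) R) d X) (f R))"
      by (simp add: F_def SRX replace_at_back)
  qed
  also have "\<dots> = (\<Sum>S\<in>replaced_tableaux lam mu d t A. \<Sum>R\<in>row_class lam ?nu S. \<Sum>X\<in>?RC S R.
      scale (q ^ later_boxes lam (replace_at X (Suc d) R) d X) (f R))"
    using finite_replaced_tableaux[OF lam nu] finite_row_class[OF lam nu] finite_row_choices[OF lam]
    by (simp add: sum.Sigma finite_SigmaI)
  also have "\<dots> = (\<Sum>S\<in>replaced_tableaux lam mu d t A.
      scale (b_coeff q lam d A S) (\<Sum>R\<in>row_class lam ?nu S. f R))"
    by (intro sum.cong refl)
      (simp add: scale_sum_right scale_sum_left[symmetric] sum_row_choices[OF lam A(1) d t])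
  finally show ?thesis .
qed

lemma psi_Theta:
  assumes "q \<noteq> 0" "n \<ge> 2" and lam: "composition n lam" and mu: "composition n mu"
    and A: "A \<in> tableaux lam mu" "row_standard lam A" and d: "1 \<le> d" and t: "t \<le> mu (d + 1)"
    and m: "m \<in> perm_module n T lam"
  shows "psi n T mu d t (Theta n T lam mu A m) =
    (\<Sum>S\<in>replaced_tableaux lam mu d t A.
      scale (b_coeff q lam d A S) (Theta n T lam (nu_comp mu d t) S m))"
proof -
  let ?nu = "nu_comp mu d t"
  note nu = composition_nu_comp[OF mu d t]
  obtain h where h: "m = x_elt n T lam * h" using m by (auto simp: perm_module_def)
  have "psi n T mu d t (Theta n T lam mu A m) = (\<Sum>S\<in>replaced_tableaux lam mu d t A.
      scale (b_coeff q lam d A S) (row_class_sum lam ?nu S)) * h"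
    unfolding h psi_Theta_eval[OF assms(1-4) d t A(1)] merge_word_tableau[OF lam]
      row_class_sum_def sum_replacements[OF lam mu A d t, of "\<lambda>R. word_sum (row_index ?nu) (word lam R)"] ..
  also have "\<dots> = (\<Sum>S\<in>replaced_tableaux lam mu d t A.
      scale (b_coeff q lam d A S) (Theta n T lam ?nu S m))"
    unfolding sum_distrib_right scale_mult_left
    by (intro sum.cong refl) (simp add: h Theta_eval[OF assms(1-3) nu] replaced_tableaux_def)
  finally show ?thesis .
qed

end

section \<open>The composition formula\<close>

theorem proposition2p14:
  fixes scale :: "'f::field \<Rightarrow> 'h::ring_1 \<Rightarrow> 'h"
    and n d t :: nat
    and q :: 'f
    and T :: "(nat \<Rightarrow> nat) \<Rightarrow> 'h"
    and lam mu :: "nat \<Rightarrow> nat"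
    and A :: "nat \<times> nat \<Rightarrow> nat"
  assumes "n \<ge> 1"
    and "q \<noteq> 0"
    and "hecke_algebra scale n q T"
    and "is_partition n lam"
    and "is_partition n mu"
    and "d \<ge> 1"
    and "t < mu (d + 1)"
    and "A \<in> tableaux lam mu"
    and "row_standard lam A"
  shows "\<forall>m \<in> perm_module n T lam.
    psi n T mu d t (Theta n T lam mu A m) =
      (\<Sum>S \<in> replaced_tableaux lam mu d t A.
        scale (b_coeff q lam d A S) (Theta n T lam (nu_comp mu d t) S m))"
proof
  fix m assume m: "m \<in> perm_module n T lam"
  have lam: "composition n lam" and mu: "composition n mu" and dec: "mu (Suc d) \<le> mu d"
    using assms by (auto simp: is_partition_def)
  \<comment> \<open>A part \<open>\<mu>\<^sub>d\<^sub>+\<^sub>1 > 0\<close> of a partition forces \<open>\<mu>\<^sub>d > 0\<close>, which gives \<open>n \<ge> 2\<close> as needed for \<open>T id = 1\<close>.\<close>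
  have "{d, Suc d} \<subseteq> {i. mu i \<noteq> 0}" using assms(7) dec by auto
  then have "(\<Sum>i\<in>{d, Suc d}. mu i) \<le> (\<Sum>i | mu i \<noteq> 0. mu i)"
    using mu by (intro sum_mono2) (auto simp: composition_def)
  then have "n \<ge> 2" using mu assms(7) dec by (simp add: composition_def)
  then show "psi n T mu d t (Theta n T lam mu A m) =
      (\<Sum>S \<in> replaced_tableaux lam mu d t A.
        scale (b_coeff q lam d A S) (Theta n T lam (nu_comp mu d t) S m))"
    using assms m by (intro hecke_algebra.psi_Theta[OF assms(3)] lam mu) auto
qed

end
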